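(* There is a constant $C>0$ such that for every $n\ge 2$ and every pair of connected shapes $S_I$ and $S_F$ of the same order $n$, the shape $S_I$ can be transformed into (a placement of) $S_F$, and $S_F$ into (a placement of) $S_I$, by a sequence of at most $C\,n\log n$ line moves (connectivity need not be preserved during the transformation). This is achieved by the transformation U-Box-Doubling described in the context, combined with reversal of line-move sequences.
   Context: Nodes occupy distinct cells of the two-dimensional square grid, cells being addressed by integer coordinates $(x,y)$. A shape is a finite set of nodes; its order is its number of nodes. Two nodes $(x_1,y_1),(x_2,y_2)$ are neighbours iff $|x_1-x_2|\le 1$ and $|y_1-y_2|\le 1$ (so diagonal adjacency counts); a shape is connected iff the graph on its nodes given by this neighbour relation is connected. A line is a set of one or more nodes occupying consecutive cells of a single row or a single column. A line move (one time step): a line of $k\ge1$ nodes occupying $(x_1,y),(x_1+1,y),\dots,(x_1+k-1,y)$ may move right to occupy $(x_1+1,y),\dots,(x_1+k,y)$ provided $(x_1+k,y)$ is empty, or left to occupy $(x_1-1,y),\dots,(x_1+k-2,y)$ provided $(x_1-1,y)$ is empty; vertical lines move up or down analogously. All nodes of the line move simultaneously in one step. Transforming a shape $A$ into a shape $B$ means applying a finite sequence of line moves to $A$ that results in some shape obtained from $B$ by rotations and translations (a placement of $B$); running time is the number of line moves. U-Box-Doubling (assume for simplicity $n$ is a power of 2): enclose $S_I$ in an $n\times n$ box; for phases $i=1,\dots,\log n$, partition the box into disjoint $2^i\times 2^i$ sub-boxes. Inductively, at the start of phase $i$ every $2^{i-1}\times2^{i-1}$ sub-box is empty or has its nodes forming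 completely filled bottommost rows plus possibly one incomplete row of consecutive left-aligned nodes (or, symmetrically, filled leftmost columns plus one bottom-aligned incomplete column, alternating with the parity of $i$). In phase $i$ (odd case), in each $2^i\times2^i$ sub-box every row-line is moved left until each row consists of consecutive nodes starting at the sub-box's left boundary, and then the columns of the sub-box are filled from the leftmost column rightwards, pushing the nodes of a possible incomplete column to its bottom; even phases are symmetric with rows and columns exchanged. After phase $\log n$ the nodes form a single line of length $n$. *)

theory Defs
  imports Complex_Main "HOL-Library.Log_Nat"
begin

type_synonym cell = "int \<times> int"
type_synonym shape = "cell set"

definition neighbours :: "cell \<Rightarrow> cell \<Rightarrow> bool" where
  "neighbours p q \<longleftrightarrow> \<bar>fst p - fst q\<bar> \<le> 1 \<and> \<bar>snd p - snd q\<bar> \<le> 1"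

definition connected_shape :: "shape \<Rightarrow> bool" where
  "connected_shape S \<longleftrightarrow>
     (\<forall>p\<in>S. \<forall>q\<in>S. (\<lambda>u v. u \<in> S \<and> v \<in> S \<and> neighbours u v)\<^sup>*\<^sup>* p q)"


definition row_line :: "int \<Rightarrow> int \<Rightarrow> nat \<Rightarrow> cell set" where
  "row_line x y k = {x..<x + int k} \<times> {y}"

definition col_line :: "int \<Rightarrow> int \<Rightarrow> nat \<Rightarrow> cell set" where
  "col_line x y k = {x} \<times> {y..<y + int k}"

text \<open>A move is the pair of the cells that the moving line occupies before and after the step.\<close>

type_synonym move = "cell set \<times> cell set"

inductive line_move :: "shape \<Rightarrow> move \<Rightarrow> bool" for S :: shape where
  right: "\<lbrakk>k \<ge> 1; row_line x y k \<subseteq> S; (x + int k, y) \<notin> S\<rbrakk>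
    \<Longrightarrow> line_move S (row_line x y k, row_line (x + 1) y k)"
| left: "\<lbrakk>k \<ge> 1; row_line x y k \<subseteq> S; (x - 1, y) \<notin> S\<rbrakk>
    \<Longrightarrow> line_move S (row_line x y k, row_line (x - 1) y k)"
| up: "\<lbrakk>k \<ge> 1; col_line x y k \<subseteq> S; (x, y + int k) \<notin> S\<rbrakk>
    \<Longrightarrow> line_move S (col_line x y k, col_line x (y + 1) k)"
| down: "\<lbrakk>k \<ge> 1; col_line x y k \<subseteq> S; (x, y - 1) \<notin> S\<rbrakk>
    \<Longrightarrow> line_move S (col_line x y k, col_line x (y - 1) k)"

fun result :: "shape \<Rightarrow> move list \<Rightarrow> shape" where
  "result S [] = S"
| "result S (m # ms) = result ((S - fst m) \<union> snd m) ms"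

fun line_moves :: "shape \<Rightarrow> move list \<Rightarrow> bool" where
  "line_moves S [] \<longleftrightarrow> True"
| "line_moves S (m # ms) \<longleftrightarrow> line_move S m \<and> line_moves (result S [m]) ms"

definition reverse_moves :: "move list \<Rightarrow> move list" where
  "reverse_moves ms = rev (map prod.swap ms)"

definition map_moves :: "(cell \<Rightarrow> cell) \<Rightarrow> move list \<Rightarrow> move list" where
  "map_moves f ms = map (map_prod (image f) (image f)) ms"


definition rot90 :: "cell \<Rightarrow> cell" where
  "rot90 p = (- snd p, fst p)"

definition rigid_motion :: "(cell \<Rightarrow> cell) \<Rightarrow> bool" where
  "rigid_motion g \<longleftrightarrow>
     (\<exists>(r::nat) a b. \<forall>p. g p = (fst ((rot90 ^^ r) p) + a, snd ((rot90 ^^ r) p) + b))"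

definition placement_of :: "shape \<Rightarrow> shape \<Rightarrow> bool" where
  "placement_of B B' \<longleftrightarrow> (\<exists>g. rigid_motion g \<and> B' = g ` B)"

definition transforms :: "shape \<Rightarrow> move list \<Rightarrow> shape \<Rightarrow> bool" where
  "transforms A ms B \<longleftrightarrow> line_moves A ms \<and> placement_of B (result A ms)"


text \<open>A procedure is a predicate on a start shape and a list of moves, telling whether the
  list is an execution of the procedure from that shape.  \<open>staged P bs\<close> executes
  \<open>P b\<close> for the members \<open>b\<close> of \<open>bs\<close>, one after the other.  Legality of the
  individual moves is required only once, in \<open>u_box_doubling\<close>.\<close>

fun staged :: "('b \<Rightarrow> shape \<Rightarrow> move list \<Rightarrow> bool) \<Rightarrow> 'b list \<Rightarrow> shape \<Rightarrow> move list \<Rightarrow> bool" where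
  "staged P [] S ms \<longleftrightarrow> ms = []"
| "staged P (b # bs) S ms \<longleftrightarrow>
     (\<exists>us vs. ms = us @ vs \<and> P b S us \<and> staged P bs (result S us) vs)"

text \<open>Square boxes are given by their bottom left cell and their side length.\<close>

definition sq_box :: "cell \<Rightarrow> nat \<Rightarrow> cell set" where
  "sq_box c w = {fst c..<fst c + int w} \<times> {snd c..<snd c + int w}"

definition push_left :: "cell \<Rightarrow> nat \<Rightarrow> shape \<Rightarrow> move list \<Rightarrow> bool" where
  "push_left c w S ms \<longleftrightarrow>
     (\<forall>(L, L') \<in> set ms. L \<union> L' \<subseteq> sq_box c w \<and> L' = (\<lambda>(x, y). (x - 1, y)) ` L) \<and>
     (\<forall>y \<in> {snd c..<snd c + int w}. \<exists>k.
        result S ms \<inter> row_line (fst c) y w = row_line (fst c) y k)"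

text \<open>Filling column number \<open>j\<close> (counted from the left boundary of the box) takes place in
  the columns from \<open>j\<close> on.  It puts there as many as possible of the nodes that are not
  yet in an earlier column, so the column ends up full, or is the incomplete, bottom-aligned
  one, or is empty.\<close>

definition fill_column :: "cell \<Rightarrow> nat \<Rightarrow> nat \<Rightarrow> shape \<Rightarrow> move list \<Rightarrow> bool" where
  "fill_column c w j S ms \<longleftrightarrow>
     (let R = {fst c + int j..<fst c + int w} \<times> {snd c..<snd c + int w} in
        (\<forall>(L, L') \<in> set ms. L \<union> L' \<subseteq> R) \<and>
        result S ms \<inter> col_line (fst c + int j) (snd c) w
          = col_line (fst c + int j) (snd c) (min w (card (S \<inter> R))))"

definition rows_to_columns :: "cell \<Rightarrow> nat \<Rightarrow> shape \<Rightarrow> move list \<Rightarrow> bool" where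
  "rows_to_columns c w S ms \<longleftrightarrow>
     (\<exists>us vs. ms = us @ vs \<and> push_left c w S us \<and>
        staged (fill_column c w) [0..<w] (result S us) vs)"

text \<open>The mirror image at the diagonal: columns are pushed down, and then the rows are filled
  from the bottommost row upwards.\<close>

definition columns_to_rows :: "cell \<Rightarrow> nat \<Rightarrow> shape \<Rightarrow> move list \<Rightarrow> bool" where
  "columns_to_rows c w S ms \<longleftrightarrow>
     rows_to_columns (prod.swap c) w (prod.swap ` S) (map_moves prod.swap ms)"

text \<open>The bottom left cells of the sub-boxes of side \<open>2 ^ i\<close> of the box of side
  \<open>2 ^ d\<close> at \<open>c\<close>.\<close>

definition sub_boxes :: "cell \<Rightarrow> nat \<Rightarrow> nat \<Rightarrow> cell set" where
  "sub_boxes c d i =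
     {(fst c + int p * 2 ^ i, snd c + int q * 2 ^ i) | p q. p < 2 ^ (d - i) \<and> q < 2 ^ (d - i)}"

definition ubox_phase :: "cell \<Rightarrow> nat \<Rightarrow> nat \<Rightarrow> shape \<Rightarrow> move list \<Rightarrow> bool" where
  "ubox_phase c d i S ms \<longleftrightarrow>
     (\<exists>bs. distinct bs \<and> set bs = sub_boxes c d i \<and>
        staged (\<lambda>b. if odd i then rows_to_columns b (2 ^ i) else columns_to_rows b (2 ^ i)) bs S ms)"

text \<open>If the order \<open>n\<close> of the shape is not a power of two, the enclosing box has as its
  side the least power of two that is at least \<open>n\<close>.\<close>

definition u_box_doubling :: "shape \<Rightarrow> move list \<Rightarrow> bool" where
  "u_box_doubling S ms \<longleftrightarrow> line_moves S ms \<and>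
     (\<exists>c. let d = ceillog2 (card S) in
        S \<subseteq> sq_box c (2 ^ d) \<and> staged (ubox_phase c d) [1..<d + 1] S ms)"

text \<open>U-Box-Doubling from \<open>A\<close>, followed by the reversal of (a placed copy of)
  U-Box-Doubling from \<open>B\<close>; the two meet in the same shape.\<close>

definition via_u_box_doubling :: "shape \<Rightarrow> move list \<Rightarrow> shape \<Rightarrow> bool" where
  "via_u_box_doubling A ms B \<longleftrightarrow>
     (\<exists>us vs g. u_box_doubling A us \<and> u_box_doubling B vs \<and> rigid_motion g \<and>
        result A us = g ` result B vs \<and>
        ms = us @ reverse_moves (map_moves g vs))"

end

theory Submission
  imports Defs
begin

text \<open>A phase with boxes of side \<open>w\<close> costs \<open>O(m + w)\<close> moves in a box with \<open>m > 0\<close> nodes.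
  Every nonempty row is pushed left in at most \<open>w\<close> moves, and there are at most \<open>2 m / w + 4\<close>
  nonempty rows, because in each of the four sub-boxes left by the preceding phase all but one of
  the nonempty rows are full.  When a column is filled, two moves bring one new node into it,
  so that all the columns together take \<open>O(m)\<close> moves, plus \<open>O(w)\<close> for pushing down the incomplete one.

  A connected shape with \<open>n\<close> nodes is covered by a walk of length at most \<open>2 n\<close>, and a piece of
  length \<open>w\<close> of the walk meets at most nine boxes.  Hence \<open>O(n / w)\<close> boxes are ever nonempty, as the
  nodes do not leave their boxes, and each of the \<open>O(log n)\<close> phases costs \<open>O(n)\<close> moves.  The final
  line depends only on \<open>n\<close> up to translation, and moves are reversible.\<close>

section \<open>Reversal and symmetries of line moves\<close>

text \<open>The obstacle is that intermediate shapes need not be connected, so the occupied boxes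
  cannot be recounted from phase to phase. They are counted on the start shape only, at every scale,
  and the induction over the phases carries the fact that the set of \<open>box_index\<close> values
  at the current scale is still that of the start shape. The independence of boxes comes from
  \<open>confined\<close>: moves that stay in a region leave everything else untouched and keep the
  number of nodes in the region. Many facts (a box is empty, a line has a given length) thereby
  reduce to cardinalities. Between phases no exact arrangement of filled and incomplete lines is
  passed on, only a bound on the number of nonempty lines, \<open>breadth\<close>. The exact
  arrangement is stated just for boxes whose nodes fit into a single line; at the top scale this
  gives the final line.\<close>

definition confined :: "cell set \<Rightarrow> move list \<Rightarrow> bool" where
  "confined R ms \<longleftrightarrow> (\<forall>(L, L')\<in>set ms. L \<union> L' \<subseteq> R)"

lemma confined_simps [simp]:
  "confined R []"
  "confined R (m # ms) \<longleftrightarrow> fst m \<union> snd m \<subseteq> R \<and> confined R ms"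
  "confined R (us @ vs) \<longleftrightarrow> confined R us \<and> confined R vs"
  by (auto simp: confined_def split_beta)

lemma confined_mono: "confined R ms \<Longrightarrow> R \<subseteq> R' \<Longrightarrow> confined R' ms"
  by (induction ms) auto

lemma result_append [simp]: "result S (us @ vs) = result (result S us) vs"
  by (induction us arbitrary: S) auto

lemma line_moves_append [simp]:
  "line_moves S (us @ vs) \<longleftrightarrow> line_moves S us \<and> line_moves (result S us) vs"
  by (induction us arbitrary: S) auto

lemma result_disjoint:
  "confined R ms \<Longrightarrow> X \<inter> R = {} \<Longrightarrow> result S ms \<inter> X = S \<inter> X"
proof (induction ms arbitrary: S)
  case (Cons m ms)
  have "(S - fst m \<union> snd m) \<inter> X = S \<inter> X" using Cons.prems by auto
  then show ?case using Cons by simp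
qed simp

lemma result_minus: "confined R ms \<Longrightarrow> result S ms - R = S - R"
  using result_disjoint[of R ms "- R" S] by blast

lemma hop_effect:
  assumes "A \<subseteq> S" "q \<notin> S" "p \<in> A" "B = insert q (A - {p})"
  shows "S - A \<union> B = insert q (S - {p})" "B \<subseteq> insert q (S - {p})" "p \<notin> insert q (S - {p})"
  using assms by blast+

text \<open>Nodes are indistinguishable, so moving a line has the same effect as letting its rear
  node \<open>p\<close> jump to the empty cell \<open>q\<close> in front. Conservation of the order
  is then immediate, and the swapped move is legal afterwards because the vacated \<open>p\<close>
  is the empty cell in front of the reversed line.\<close>

lemma line_move_hop:
  assumes "line_move S m"
  obtains p q where "p \<in> S" "q \<notin> S" "p \<in> fst m" "snd m = insert q (fst m - {p})"
    "S - fst m \<union> snd m = insert q (S - {p})"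
    "line_move (insert q (S - {p})) (prod.swap m)"
  using assms
proof cases
  case (right k x y)
  have eq: "row_line (x + 1) y k = insert (x + int k, y) (row_line x y k - {(x, y)})"
    and mem: "(x, y) \<in> row_line x y k"
    using right(2) by (auto simp: row_line_def col_line_def)
  note hop = hop_effect[OF right(3,4) mem eq]
  have "line_move (insert (x + int k, y) (S - {(x, y)})) (row_line (x + 1) y k, row_line (x + 1 - 1) y k)"
    by (rule line_move.left) (use right(2) hop(2,3) in \<open>simp_all add: algebra_simps\<close>)
  then have "line_move (insert (x + int k, y) (S - {(x, y)})) (prod.swap m)"
    using right(1) by (simp add: algebra_simps)
  then show thesis
    using that[OF subsetD[OF right(3) mem] right(4)] mem eq hop(1) right(1) by simp
next
  case (left k x y)
  have eq: "row_line (x - 1) y k = insert (x - 1, y) (row_line x y k - {(x + int k - 1, y)})"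
    and mem: "(x + int k - 1, y) \<in> row_line x y k"
    using left(2) by (auto simp: row_line_def col_line_def)
  note hop = hop_effect[OF left(3,4) mem eq]
  have "line_move (insert (x - 1, y) (S - {(x + int k - 1, y)})) (row_line (x - 1) y k, row_line (x - 1 + 1) y k)"
    by (rule line_move.right) (use left(2) hop(2,3) in \<open>simp_all add: algebra_simps\<close>)
  then have "line_move (insert (x - 1, y) (S - {(x + int k - 1, y)})) (prod.swap m)"
    using left(1) by (simp add: algebra_simps)
  then show thesis
    using that[OF subsetD[OF left(3) mem] left(4)] mem eq hop(1) left(1) by simp
next
  case (up k x y)
  have eq: "col_line x (y + 1) k = insert (x, y + int k) (col_line x y k - {(x, y)})"
    and mem: "(x, y) \<in> col_line x y k"
    using up(2) by (auto simp: row_line_def col_line_def)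
  note hop = hop_effect[OF up(3,4) mem eq]
  have "line_move (insert (x, y + int k) (S - {(x, y)})) (col_line x (y + 1) k, col_line x (y + 1 - 1) k)"
    by (rule line_move.down) (use up(2) hop(2,3) in \<open>simp_all add: algebra_simps\<close>)
  then have "line_move (insert (x, y + int k) (S - {(x, y)})) (prod.swap m)"
    using up(1) by (simp add: algebra_simps)
  then show thesis
    using that[OF subsetD[OF up(3) mem] up(4)] mem eq hop(1) up(1) by simp
next
  case (down k x y)
  have eq: "col_line x (y - 1) k = insert (x, y - 1) (col_line x y k - {(x, y + int k - 1)})"
    and mem: "(x, y + int k - 1) \<in> col_line x y k"
    using down(2) by (auto simp: row_line_def col_line_def)
  note hop = hop_effect[OF down(3,4) mem eq]
  have "line_move (insert (x, y - 1) (S - {(x, y + int k - 1)})) (col_line x (y - 1) k, col_line x (y - 1 + 1) k)"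
    by (rule line_move.up) (use down(2) hop(2,3) in \<open>simp_all add: algebra_simps\<close>)
  then have "line_move (insert (x, y - 1) (S - {(x, y + int k - 1)})) (prod.swap m)"
    using down(1) by (simp add: algebra_simps)
  then show thesis
    using that[OF subsetD[OF down(3) mem] down(4)] mem eq hop(1) down(1) by simp
qed

lemma line_moves_card:
  assumes "line_moves S ms" "finite S"
  shows "finite (result S ms) \<and> card (result S ms) = card S"
  using assms
proof (induction ms arbitrary: S)
  case (Cons m ms)
  have "line_move S m" using Cons.prems by simp
  then obtain p q where *: "p \<in> S" "q \<notin> S" "S - fst m \<union> snd m = insert q (S - {p})"
    by (rule line_move_hop)
  have "card (insert q (S - {p})) = card S"
    using * Cons.prems by (metis Diff_iff card_insert_disjoint card_Suc_Diff1 finite_Diff)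
  then show ?case using Cons.IH[of "S - fst m \<union> snd m"] Cons.prems * by simp
qed simp

text \<open>Outside \<open>R\<close> nothing changes and the order is conserved, hence so is the
  count inside \<open>R\<close>.\<close>

lemma confined_card:
  assumes "line_moves S ms" "finite S" "confined R ms"
  shows "card (result S ms \<inter> R) = card (S \<inter> R)"
proof -
  have "card (result S ms) = card S" "finite (result S ms)"
    using line_moves_card assms by auto
  moreover have "card (result S ms) = card (result S ms \<inter> R) + card (result S ms - R)"
    using calculation by (metis card_Int_Diff)
  moreover have "card S = card (S \<inter> R) + card (S - R)"
    using assms by (metis card_Int_Diff)
  ultimately show ?thesis using result_minus[OF assms(3), of S] by simp
qed

lemma line_moves_reverse:
  assumes "line_moves S ms"
  shows "line_moves (result S ms) (reverse_moves ms) \<and>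
    result (result S ms) (reverse_moves ms) = S"
  using assms
proof (induction ms arbitrary: S)
  case (Cons m ms)
  have "line_move S m" using Cons.prems by simp
  then obtain p q where *: "p \<in> S" "q \<notin> S" "p \<in> fst m" "snd m = insert q (fst m - {p})"
      "S - fst m \<union> snd m = insert q (S - {p})"
      "line_move (insert q (S - {p})) (prod.swap m)"
    by (rule line_move_hop)
  have "fst m \<subseteq> S" using \<open>line_move S m\<close> by cases auto
  \<comment> \<open>Undoing the first move gives back exactly \<open>S\<close>, since its line
    \<open>fst m\<close> consisted of nodes of \<open>S\<close>.\<close>
  then have restore: "insert q (S - {p}) - snd m \<union> fst m = S"
    using *(1-4) by auto
  let ?T = "S - fst m \<union> snd m"
  have IH: "line_moves (result ?T ms) (reverse_moves ms)" "result (result ?T ms) (reverse_moves ms) = ?T"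
    using Cons.IH[of ?T] Cons.prems by simp_all
  have rev: "reverse_moves (m # ms) = reverse_moves ms @ [prod.swap m]"
    by (simp add: reverse_moves_def)
  show ?case unfolding rev line_moves_append result_append result.simps(2)[of S] IH
    using IH(1) *(5,6) restore by simp
qed (simp add: reverse_moves_def)

section \<open>Symmetries of the grid acting on move sequences\<close>

lemma result_map_moves:
  assumes "inj f"
  shows "result (f ` S) (map_moves f ms) = f ` result S ms"
proof (induction ms arbitrary: S)
  case (Cons m ms)
  have "f ` S - f ` fst m \<union> f ` snd m = f ` (S - fst m \<union> snd m)"
    using assms by (simp add: image_Un image_set_diff)
  then show ?case using Cons by (simp add: map_moves_def)
qed (simp add: map_moves_def)

text \<open>\<open>f\<close> is kept abstract because two symmetries are needed: the reflection at
  the diagonal turns results on rows into results on columns, and a translation places the run of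
  the second shape. The reflection is no \<open>rigid_motion\<close>; it serves inside boxes and
  never as a placement.\<close>

lemma line_moves_map_moves:
  assumes "inj f"
    and "\<And>S m. line_move S m \<Longrightarrow> line_move (f ` S) (f ` fst m, f ` snd m)"
  shows "line_moves S ms \<Longrightarrow> line_moves (f ` S) (map_moves f ms)"
proof (induction ms arbitrary: S)
  case (Cons m ms)
  have "f ` S - f ` fst m \<union> f ` snd m = f ` (S - fst m \<union> snd m)"
    using assms by (simp add: image_Un image_set_diff)
  then show ?case using Cons assms(2)
    by (simp add: map_moves_def map_prod_def split_beta)
qed (simp add: map_moves_def)

lemma swap_image_line [simp]:
  "prod.swap ` row_line x y k = col_line y x k"
  "prod.swap ` col_line x y k = row_line y x k"
  by (auto simp: row_line_def col_line_def image_iff)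

lemma line_move_swap:
  assumes "line_move S m"
  shows "line_move (prod.swap ` S) (prod.swap ` fst m, prod.swap ` snd m)"
  using assms
proof cases
  case (right k x y)
  then show ?thesis using line_move.up[of k y x "prod.swap ` S"] image_mono[OF right(3), of prod.swap]
    by auto
next
  case (left k x y)
  then show ?thesis using line_move.down[of k y x "prod.swap ` S"] image_mono[OF left(3), of prod.swap]
    by auto
next
  case (up k x y)
  then show ?thesis using line_move.right[of k y x "prod.swap ` S"] image_mono[OF up(3), of prod.swap]
    by auto
next
  case (down k x y)
  then show ?thesis using line_move.left[of k y x "prod.swap ` S"] image_mono[OF down(3), of prod.swap]
    by auto
qed

lemma translate_image_line [simp]:
  "(\<lambda>p. (fst p + a, snd p + b)) ` row_line x y k = row_line (x + a) (y + b) k"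
  "(\<lambda>p. (fst p + a, snd p + b)) ` col_line x y k = col_line (x + a) (y + b) k"
proof -
  have "(u, v) \<in> (\<lambda>p. (fst p + a, snd p + b)) ` X \<longleftrightarrow> (u - a, v - b) \<in> X" for u v X
    by (force simp: image_iff)
  then show
    "(\<lambda>p. (fst p + a, snd p + b)) ` row_line x y k = row_line (x + a) (y + b) k"
    "(\<lambda>p. (fst p + a, snd p + b)) ` col_line x y k = col_line (x + a) (y + b) k"
    by (auto simp: row_line_def col_line_def)
qed

lemma line_move_translate:
  fixes a b :: int
  defines "t \<equiv> (\<lambda>p. (fst p + a, snd p + b))"
  assumes "line_move S m"
  shows "line_move (t ` S) (t ` fst m, t ` snd m)"
proof -
  have mem: "(u, v) \<in> t ` S \<longleftrightarrow> (u - a, v - b) \<in> S" for u v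
    by (force simp: image_iff t_def)
  note line = translate_image_line[of a b, folded t_def]
  from assms(2) show ?thesis
  proof cases
    case (right k x y)
    then show ?thesis
      using line_move.right[of k "x + a" "y + b" "t ` S"] image_mono[OF right(3), of t]
      by (simp add: line mem algebra_simps)
  next
    case (left k x y)
    then show ?thesis
      using line_move.left[of k "x + a" "y + b" "t ` S"] image_mono[OF left(3), of t]
      by (simp add: line mem algebra_simps)
  next
    case (up k x y)
    then show ?thesis
      using line_move.up[of k "x + a" "y + b" "t ` S"] image_mono[OF up(3), of t]
      by (simp add: line mem algebra_simps)
  next
    case (down k x y)
    then show ?thesis
      using line_move.down[of k "x + a" "y + b" "t ` S"] image_mono[OF down(3), of t]
      by (simp add: line mem algebra_simps)
  qed
qed

lemma map_moves_swap_swap [simp]: "map_moves prod.swap (map_moves prod.swap ms) = ms"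
  by (induction ms) (auto simp: map_moves_def image_image)

lemma length_map_moves [simp]: "length (map_moves f ms) = length ms"
  by (simp add: map_moves_def)

lemma confined_map_moves:
  "confined R ms \<Longrightarrow> confined (f ` R) (map_moves f ms)"
  by (induction ms) (auto simp: map_moves_def)

lemma line_moves_swap:
  "line_moves S ms \<Longrightarrow> line_moves (prod.swap ` S) (map_moves prod.swap ms)"
  by (intro line_moves_map_moves line_move_swap) auto

lemma result_swap:
  "result (prod.swap ` S) (map_moves prod.swap ms) = prod.swap ` result S ms"
  by (intro result_map_moves) auto

section \<open>Single moves that carry one node into a hole\<close>

text \<open>The moving line is the full stretch from just after the hole \<open>x'\<close> up to the
  node at \<open>x\<close>; one move exchanges node and hole. That it is a shift to the left is
  recorded because \<open>push_left\<close> demands this of each of its moves.\<close>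

lemma hop_left:
  assumes "x' < x" "{x'<..x} \<times> {y} \<subseteq> S" "(x', y) \<notin> S"
  obtains m where "line_move S m" "fst m \<union> snd m \<subseteq> {x'..x} \<times> {y}"
    "snd m = (\<lambda>(x, y). (x - 1, y)) ` fst m"
    "S - fst m \<union> snd m = insert (x', y) (S - {(x, y)})"
proof -
  define k where "k = nat (x - x')"
  have k: "k \<ge> 1" "x' + int k = x" using assms(1) by (auto simp: k_def)
  have line: "row_line (x' + 1) y k = {x'<..x} \<times> {y}"
    and eq: "row_line x' y k = insert (x', y) (row_line (x' + 1) y k - {(x, y)})"
    using k by (auto simp: row_line_def)
  have shift: "row_line x' y k = (\<lambda>(x, y). (x - 1, y)) ` row_line (x' + 1) y k"
    using translate_image_line(1)[of "-1" 0 "x' + 1" y k] by (simp add: split_beta')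
  have "line_move S (row_line (x' + 1) y k, row_line (x' + 1 - 1) y k)"
    by (rule line_move.left) (use k assms(3) assms(2)[folded line] in simp_all)
  then have "line_move S (row_line (x' + 1) y k, row_line x' y k)" by simp
  moreover have "S - row_line (x' + 1) y k \<union> row_line x' y k = insert (x', y) (S - {(x, y)})"
    by (rule hop_effect(1)[OF _ assms(3) _ eq]) (use assms(1) assms(2)[folded line] line in simp_all)
  moreover have "row_line (x' + 1) y k \<union> row_line x' y k \<subseteq> {x'..x} \<times> {y}"
    using k by (auto simp: row_line_def)
  ultimately show thesis using that[of "(row_line (x' + 1) y k, row_line x' y k)"] shift by simp
qed

lemma hop_up:
  assumes "y < y'" "{x} \<times> {y..<y'} \<subseteq> S" "(x, y') \<notin> S"
  obtains m where "line_move S m" "fst m \<union> snd m \<subseteq> {x} \<times> {y..y'}"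
    "S - fst m \<union> snd m = insert (x, y') (S - {(x, y)})"
proof -
  define k where "k = nat (y' - y)"
  have k: "k \<ge> 1" "y + int k = y'" using assms(1) by (auto simp: k_def)
  have line: "col_line x y k = {x} \<times> {y..<y'}"
    and eq: "col_line x (y + 1) k = insert (x, y') (col_line x y k - {(x, y)})"
    using k by (auto simp: col_line_def)
  have "line_move S (col_line x y k, col_line x (y + 1) k)"
    by (rule line_move.up) (use k assms(3) assms(2)[folded line] in simp_all)
  then have "line_move S (col_line x y k, col_line x (y + 1) k)" by simp
  moreover have "S - col_line x y k \<union> col_line x (y + 1) k = insert (x, y') (S - {(x, y)})"
    by (rule hop_effect(1)[OF _ assms(3) _ eq]) (use assms(1) assms(2)[folded line] line in simp_all)
  moreover have "col_line x y k \<union> col_line x (y + 1) k \<subseteq> {x} \<times> {y..y'}"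
    using k by (auto simp: col_line_def)
  ultimately show thesis using that[of "(col_line x y k, col_line x (y + 1) k)"] by simp
qed

lemma hop_down:
  assumes "y' < y" "{x} \<times> {y'<..y} \<subseteq> S" "(x, y') \<notin> S"
  obtains m where "line_move S m" "fst m \<union> snd m \<subseteq> {x} \<times> {y'..y}"
    "S - fst m \<union> snd m = insert (x, y') (S - {(x, y)})"
proof -
  define k where "k = nat (y - y')"
  have k: "k \<ge> 1" "y' + int k = y" using assms(1) by (auto simp: k_def)
  have line: "col_line x (y' + 1) k = {x} \<times> {y'<..y}"
    and eq: "col_line x y' k = insert (x, y') (col_line x (y' + 1) k - {(x, y)})"
    using k by (auto simp: col_line_def)
  have "line_move S (col_line x (y' + 1) k, col_line x (y' + 1 - 1) k)"
    by (rule line_move.down) (use k assms(3) assms(2)[folded line] in simp_all)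
  then have "line_move S (col_line x (y' + 1) k, col_line x y' k)" by simp
  moreover have "S - col_line x (y' + 1) k \<union> col_line x y' k = insert (x, y') (S - {(x, y)})"
    by (rule hop_effect(1)[OF _ assms(3) _ eq]) (use assms(1) assms(2)[folded line] line in simp_all)
  moreover have "col_line x (y' + 1) k \<union> col_line x y' k \<subseteq> {x} \<times> {y'..y}"
    using k by (auto simp: col_line_def)
  ultimately show thesis using that[of "(col_line x (y' + 1) k, col_line x y' k)"] by simp
qed

section \<open>One box\<close>

text \<open>Stage \<open>b\<close> works inside \<open>R b\<close> only, and these regions are
  disjoint. Hence each stage still finds the original contents of its region, and the property
  \<open>Q b\<close> it establishes outlives the later stages. This is why the hypothesis speaks of
  all finite \<open>T\<close> that agree with \<open>S\<close> on \<open>R b\<close>. It serves for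
  the rows of a box and for the boxes of a phase.\<close>

lemma staged_local:
  fixes R :: "'b \<Rightarrow> cell set"
  assumes "distinct bs" "finite S"
    and "\<And>b b'. b \<in> set bs \<Longrightarrow> b' \<in> set bs \<Longrightarrow> b \<noteq> b' \<Longrightarrow> R b \<inter> R b' = {}"
    and "\<And>b T. b \<in> set bs \<Longrightarrow> finite T \<Longrightarrow> T \<inter> R b = S \<inter> R b \<Longrightarrow>
      \<exists>us. line_moves T us \<and> confined (R b) us \<and> P b T us \<and> Q b (result T us \<inter> R b) \<and> length us \<le> f b"
  shows "\<exists>ms. line_moves S ms \<and> confined (\<Union>b\<in>set bs. R b) ms \<and> staged P bs S ms \<and>
    (\<forall>b\<in>set bs. Q b (result S ms \<inter> R b)) \<and> length ms \<le> (\<Sum>b\<in>set bs. f b)"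
  using assms
proof (induction bs arbitrary: S)
  case (Cons b bs)
  from Cons.prems(4)[of b S] Cons.prems(2)
  obtain us where us: "line_moves S us" "confined (R b) us" "P b S us" "Q b (result S us \<inter> R b)"
      "length us \<le> f b"
    by auto
  let ?S = "result S us"
  have disj: "R b' \<inter> R b = {}" if "b' \<in> set bs" for b'
    using Cons.prems(1) that by (intro Cons.prems(3)) auto
  have same: "?S \<inter> R b' = S \<inter> R b'" if "b' \<in> set bs" for b'
    using result_disjoint[OF us(2) disj[OF that]] .
  have "finite ?S" using line_moves_card us(1) Cons.prems(2) by blast
  have "\<exists>ms. line_moves ?S ms \<and> confined (\<Union>b\<in>set bs. R b) ms \<and> staged P bs ?S ms \<and>
    (\<forall>b\<in>set bs. Q b (result ?S ms \<inter> R b)) \<and> length ms \<le> (\<Sum>b\<in>set bs. f b)"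
  proof (rule Cons.IH)
    show "\<exists>us. line_moves T us \<and> confined (R b') us \<and> P b' T us \<and> Q b' (result T us \<inter> R b') \<and> length us \<le> f b'"
      if "b' \<in> set bs" "finite T" "T \<inter> R b' = ?S \<inter> R b'" for b' T
      using that same by (intro Cons.prems(4)) auto
  qed (use Cons.prems(1,3) \<open>finite ?S\<close> in auto)
  then obtain vs where vs: "line_moves ?S vs" "confined (\<Union>b\<in>set bs. R b) vs" "staged P bs ?S vs"
      "\<forall>b\<in>set bs. Q b (result ?S vs \<inter> R b)" "length vs \<le> (\<Sum>b\<in>set bs. f b)"
    by blast
  have "R b \<inter> (\<Union>b\<in>set bs. R b) = {}" using disj by blast
  then have "result ?S vs \<inter> R b = ?S \<inter> R b" by (rule result_disjoint[OF vs(2)])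
  moreover have "staged P (b # bs) S (us @ vs)" using us(3) vs(3) by auto
  moreover have "confined (\<Union>b\<in>set (b # bs). R b) (us @ vs)"
    using us(2) vs(2) by (auto elim!: confined_mono)
  ultimately show ?case
    using us vs Cons.prems(1) by (intro exI[of _ "us @ vs"]) auto
qed simp

lemma staged_moves:
  "staged P bs S ms \<Longrightarrow> (\<And>b T us. P b T us \<Longrightarrow> \<forall>m\<in>set us. G m) \<Longrightarrow> \<forall>m\<in>set ms. G m"
  by (induction bs arbitrary: S ms) fastforce+

lemma line_0 [simp]: "row_line x y 0 = {}" "col_line x y 0 = {}"
  by (auto simp: row_line_def col_line_def)

lemma card_line [simp]: "card (row_line x y k) = k" "card (col_line x y k) = k"
  by (auto simp: row_line_def col_line_def card_cartesian_product)

lemma finite_line [simp]: "finite (row_line x y k)" "finite (col_line x y k)"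
  by (auto simp: row_line_def col_line_def)

lemma row_line_mono: "k \<le> l \<Longrightarrow> row_line x y k \<subseteq> row_line x y l"
  by (auto simp: row_line_def)

text \<open>Each step moves the block at the right end, so that the rightmost node advances by one
  cell to the left.\<close>

lemma compact_row_aux:
  assumes "S \<inter> row_line x y w \<subseteq> row_line x y t" "t \<le> w"
  shows "\<exists>ms k. line_moves S ms \<and> confined (row_line x y w) ms \<and>
    (\<forall>m\<in>set ms. snd m = (\<lambda>(x, y). (x - 1, y)) ` fst m) \<and>
    result S ms \<inter> row_line x y w = row_line x y k \<and> length ms \<le> t"
  using assms
proof (induction t arbitrary: S)
  case 0
  then show ?case by (intro exI[of _ "[]"] exI[of _ 0]) auto
next
  case (Suc t)
  have last: "row_line x y (Suc t) = insert (x + int t, y) (row_line x y t)"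
    by (auto simp: row_line_def)
  show ?case
  proof (cases "(x + int t, y) \<in> S")
    case False
    then have "S \<inter> row_line x y w \<subseteq> row_line x y t" using Suc.prems last by auto
    from Suc.IH[OF this] Suc.prems show ?thesis by (meson Suc_leD le_Suc_eq)
  next
    case last_in: True
    show ?thesis
    proof (cases "row_line x y (Suc t) \<subseteq> S")
      case True
      then have "S \<inter> row_line x y w = row_line x y (Suc t)"
        using Suc.prems row_line_mono[OF Suc.prems(2)] by blast
      then show ?thesis by (intro exI[of _ "[]"] exI[of _ "Suc t"]) auto
    next
      case False
      define H where "H = {u \<in> {x..<x + int t}. (u, y) \<notin> S}"
      have "H \<noteq> {}" using False last_in unfolding H_def last by (auto simp: row_line_def)
      moreover have "finite H" unfolding H_def by (rule finite_subset[of _ "{x..<x + int t}"]) auto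
      moreover define x' where "x' = Max H"
      ultimately have x': "x' \<in> H" "\<And>u. u \<in> H \<Longrightarrow> u \<le> x'" by simp_all
      then have bounds: "x \<le> x'" "x' < x + int t" "(x', y) \<notin> S" by (auto simp: H_def)
      have "{x'<..x + int t} \<times> {y} \<subseteq> S"
      proof clarify
        fix u assume u: "u \<in> {x'<..x + int t}"
        show "(u, y) \<in> S"
        proof (rule ccontr)
          assume "(u, y) \<notin> S"
          then have "u \<noteq> x + int t" using last_in by auto
          then have "u \<in> H" using u bounds \<open>(u, y) \<notin> S\<close> by (auto simp: H_def)
          then show False using x'(2)[of u] u by simp
        qed
      qed
      then obtain m where m: "line_move S m" "fst m \<union> snd m \<subseteq> {x'..x + int t} \<times> {y}"
          "snd m = (\<lambda>(x, y). (x - 1, y)) ` fst m"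
          "S - fst m \<union> snd m = insert (x', y) (S - {(x + int t, y)})"
        using hop_left[OF bounds(2) _ bounds(3)] by blast
      let ?S = "insert (x', y) (S - {(x + int t, y)})"
      have sub: "{x'..x + int t} \<times> {y} \<subseteq> row_line x y w"
        using bounds Suc.prems(2) by (auto simp: row_line_def)
      have "(x', y) \<in> row_line x y t" using bounds by (auto simp: row_line_def)
      then have "?S \<inter> row_line x y w \<subseteq> row_line x y t" using Suc.prems(1) last by blast
      from Suc.IH[OF this] Suc.prems(2) obtain ms k where
        "line_moves ?S ms" "confined (row_line x y w) ms"
        "\<forall>m\<in>set ms. snd m = (\<lambda>(x, y). (x - 1, y)) ` fst m"
        "result ?S ms \<inter> row_line x y w = row_line x y k" "length ms \<le> t"
        by auto
      then show ?thesis using m sub by (intro exI[of _ "m # ms"] exI[of _ k]) auto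
    qed
  qed
qed

text \<open>The bound 0 for a row without nodes makes the cost of pushing left proportional to the
  number of nonempty rows.\<close>

lemma compact_row:
  "\<exists>ms k. line_moves S ms \<and> confined (row_line x y w) ms \<and>
    (\<forall>m\<in>set ms. snd m = (\<lambda>(x, y). (x - 1, y)) ` fst m) \<and>
    result S ms \<inter> row_line x y w = row_line x y k \<and>
    length ms \<le> (if S \<inter> row_line x y w = {} then 0 else w)"
proof (cases "S \<inter> row_line x y w = {}")
  case True
  then show ?thesis using compact_row_aux[of S x y w 0] by auto
next
  case False
  then show ?thesis using compact_row_aux[of S x y w w] by auto
qed

text \<open>Reflection of \<open>compact_row\<close>. The length of the resulting line is found by
  counting, as the moves stay in the column.\<close>

lemma compact_col:
  assumes "finite S"
  shows "\<exists>ms. line_moves S ms \<and> confined (col_line x y w) ms \<and>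
    result S ms \<inter> col_line x y w = col_line x y (card (S \<inter> col_line x y w)) \<and> length ms \<le> w"
proof -
  obtain ms k where ms: "line_moves (prod.swap ` S) ms" "confined (row_line y x w) ms"
      "result (prod.swap ` S) ms \<inter> row_line y x w = row_line y x k"
      "length ms \<le> (if prod.swap ` S \<inter> row_line y x w = {} then 0 else w)"
    using compact_row[of "prod.swap ` S" y x w] by blast
  have "length ms \<le> w" using ms(4) by (simp split: if_splits)
  let ?ms = "map_moves prod.swap ms"
  have lm: "line_moves S ?ms" using line_moves_swap[OF ms(1)] by (simp add: image_image)
  have conf: "confined (col_line x y w) ?ms" using confined_map_moves[OF ms(2), of prod.swap] by simp
  have "result S ?ms = prod.swap ` result (prod.swap ` S) ms"
    using result_swap[of "prod.swap ` S" ms] by (simp add: image_image)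
  then have "result S ?ms \<inter> col_line x y w = prod.swap ` (result (prod.swap ` S) ms \<inter> row_line y x w)"
    by (simp add: image_Int)
  then have res: "result S ?ms \<inter> col_line x y w = col_line x y k" using ms(3) by simp
  then have "k = card (S \<inter> col_line x y w)"
    using confined_card[OF lm assms conf] by simp
  then show ?thesis using lm conf res \<open>length ms \<le> w\<close> by (intro exI[of _ ?ms]) auto
qed

lemma push_left_exists:
  assumes "finite S"
  shows "\<exists>ms. line_moves S ms \<and> confined (sq_box c w) ms \<and> push_left c w S ms \<and>
    length ms \<le> w * card (snd ` (S \<inter> sq_box c w))"
proof -
  let ?ys = "[snd c..snd c + int w - 1]"
  let ?shift = "\<lambda>m. snd m = (\<lambda>(x, y). (x - 1, y)) ` fst m"
  let ?R = "\<lambda>y. row_line (fst c) y w"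
  have set: "set ?ys = {snd c..<snd c + int w}" by auto
  have "\<exists>ms. line_moves S ms \<and> confined (\<Union>y\<in>set ?ys. ?R y) ms \<and>
      staged (\<lambda>_ _ us. \<forall>m\<in>set us. ?shift m) ?ys S ms \<and>
      (\<forall>y\<in>set ?ys. \<exists>k. result S ms \<inter> ?R y = row_line (fst c) y k) \<and>
      length ms \<le> (\<Sum>y\<in>set ?ys. if S \<inter> ?R y = {} then 0 else w)"
  proof (rule staged_local)
    show "?R y \<inter> ?R y' = {}" if "y \<noteq> y'" for y y' using that by (auto simp: row_line_def)
    show "\<exists>us. line_moves T us \<and> confined (?R y) us \<and> (\<forall>m\<in>set us. ?shift m) \<and>
        (\<exists>k. result T us \<inter> ?R y = row_line (fst c) y k) \<and>
        length us \<le> (if S \<inter> ?R y = {} then 0 else w)"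
      if "T \<inter> ?R y = S \<inter> ?R y" for y T
      using compact_row[of T "fst c" y w] that by metis
  qed (use assms in auto)
  then obtain ms where ms: "line_moves S ms" "confined (\<Union>y\<in>set ?ys. ?R y) ms"
      "staged (\<lambda>_ _ us. \<forall>m\<in>set us. ?shift m) ?ys S ms"
      "\<forall>y\<in>set ?ys. \<exists>k. result S ms \<inter> ?R y = row_line (fst c) y k"
      "length ms \<le> (\<Sum>y\<in>set ?ys. if S \<inter> ?R y = {} then 0 else w)"
    by blast
  have box: "(\<Union>y\<in>set ?ys. ?R y) = sq_box c w"
    unfolding set by (auto simp: sq_box_def row_line_def)
  have "\<forall>m\<in>set ms. ?shift m" using staged_moves[OF ms(3)] by blast
  moreover have "confined (sq_box c w) ms" using ms(2) box by simp
  ultimately have "push_left c w S ms"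
    using ms(4) unfolding push_left_def confined_def set by (simp add: split_beta)
  have rows: "{y \<in> set ?ys. S \<inter> ?R y \<noteq> {}} = snd ` (S \<inter> sq_box c w)"
    unfolding set by (force simp: sq_box_def row_line_def)
  have "(\<Sum>y\<in>set ?ys. if S \<inter> ?R y = {} then 0 else w) = (\<Sum>y | y \<in> set ?ys \<and> S \<inter> ?R y \<noteq> {}. w)"
    by (rule sum.mono_neutral_cong_right) auto
  also have "\<dots> = w * card (snd ` (S \<inter> sq_box c w))" unfolding rows by simp
  finally show ?thesis using ms(1,5) \<open>push_left c w S ms\<close> \<open>confined (sq_box c w) ms\<close> by auto
qed

section \<open>Column filling in left-aligned rectangles\<close>

text \<open>Width and height are separate because, once some columns are dealt with, what remains of
  a box is a narrower rectangle of full height.\<close>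

definition rect :: "int \<Rightarrow> int \<Rightarrow> nat \<Rightarrow> nat \<Rightarrow> cell set" where
  "rect a b v w = {a..<a + int v} \<times> {b..<b + int w}"

text \<open>The invariant of column filling: for a rectangle \<open>R\<close> it says that rows have
  no gaps and start at the left border. Stated through neighbouring cells, it passes to every part
  of \<open>R\<close>, in particular to what remains when the first column is cut off.\<close>

definition left_closed :: "cell set \<Rightarrow> shape \<Rightarrow> bool" where
  "left_closed R S \<longleftrightarrow> (\<forall>x y. (x, y) \<in> S \<inter> R \<longrightarrow> (x - 1, y) \<in> R \<longrightarrow> (x - 1, y) \<in> S)"

lemma left_closed_row:
  assumes "left_closed (rect a b v w) S" "(x, y) \<in> S \<inter> rect a b v w" "a \<le> u" "u \<le> x"
  shows "(u, y) \<in> S"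
  using assms(4,3)
proof (induction u rule: int_le_induct)
  case base
  then show ?case using assms(2) by simp
next
  case (step i)
  then have "(i, y) \<in> S \<inter> rect a b v w" "(i - 1, y) \<in> rect a b v w"
    using assms(2) by (auto simp: rect_def)
  then show ?case using assms(1) by (auto simp: left_closed_def)
qed

text \<open>Among all pairs of a hole of the first column and a row that reaches beyond it, a closest
  one is chosen.  The first column is then occupied between the two, so that one vertical and one
  horizontal move carry the last node of the row to the hole.\<close>

lemma fill_hole:
  fixes a b :: int and v w :: nat
  defines "R \<equiv> rect a b v w"
  assumes "finite S" "left_closed R S"
    and hole: "(a, y0') \<in> R - S" and extra: "(x0, y0) \<in> S \<inter> R" "x0 > a"
  shows "\<exists>ms. line_moves S ms \<and> confined R ms \<and> left_closed R (result S ms) \<and>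
    card (result S ms \<inter> col_line a b w) = Suc (card (S \<inter> col_line a b w)) \<and> length ms = 2"
proof -
  define good where "good p \<longleftrightarrow> (a, snd p) \<in> R - S \<and> (\<exists>x>a. (x, fst p) \<in> S \<inter> R)" for p
  have "good (y0, y0')" using hole extra by (auto simp: good_def)
  then obtain p where p: "good p" "\<And>q. good q \<Longrightarrow> nat \<bar>fst p - snd p\<bar> \<le> nat \<bar>fst q - snd q\<bar>"
    using ex_has_least_nat[of good _ "\<lambda>p. nat \<bar>fst p - snd p\<bar>"] by blast
  define y y' where "y = fst p" and "y' = snd p"
  have y': "(a, y') \<in> R" "(a, y') \<notin> S" using p(1) by (auto simp: good_def y'_def)
  obtain x1 where x1: "x1 > a" "(x1, y) \<in> S \<inter> R" using p(1) by (auto simp: good_def y_def)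
  \<comment> \<open>A further hole at \<open>z\<close> would form, with the same row
    \<open>y\<close>, a good pair at smaller distance.\<close>
  have between: "(a, z) \<in> S" if "min y y' \<le> z" "z \<le> max y y'" "z \<noteq> y'" for z
  proof (rule ccontr)
    assume z: "(a, z) \<notin> S"
    have "(a, z) \<in> R" using that y' x1 by (auto simp: R_def rect_def)
    then have "good (y, z)" using z x1 by (auto simp: good_def)
    from p(2)[OF this] show False using that unfolding y_def[symmetric] y'_def[symmetric] by auto
  qed
  have ay: "(a, y) \<in> S"
    using left_closed_row[OF assms(3)[unfolded R_def] x1(2)[unfolded R_def]] x1(1) by simp
  then have "y \<noteq> y'" using y' by auto
  have "\<exists>m. line_move S m \<and> fst m \<union> snd m \<subseteq> {a} \<times> {min y y'..max y y'} \<and>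
      S - fst m \<union> snd m = insert (a, y') (S - {(a, y)})"
  proof (cases "y < y'")
    case True
    have "{a} \<times> {y..<y'} \<subseteq> S" using between True by auto
    from hop_up[OF True this y'(2)] show ?thesis using True by (metis max.strict_order_iff min.strict_order_iff max.commute)
  next
    case False
    then have less: "y' < y" using \<open>y \<noteq> y'\<close> by simp
    have "{a} \<times> {y'<..y} \<subseteq> S" using between less by auto
    from hop_down[OF less this y'(2)] show ?thesis using less by (metis max.strict_order_iff min.strict_order_iff min.commute)
  qed
  then obtain m1 where m1: "line_move S m1" "fst m1 \<union> snd m1 \<subseteq> {a} \<times> {min y y'..max y y'}"
      "S - fst m1 \<union> snd m1 = insert (a, y') (S - {(a, y)})"
    by blast
  let ?S1 = "insert (a, y') (S - {(a, y)})"
  define H where "H = {x. (x, y) \<in> S \<inter> R}"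
  have "finite H"
    by (rule finite_subset[of _ "{a..<a + int v}"]) (auto simp: H_def R_def rect_def)
  define x where "x = Max H"
  have x: "x \<in> H" "\<And>u. u \<in> H \<Longrightarrow> u \<le> x"
    using \<open>finite H\<close> x1 Max_in[of H] by (auto simp: x_def H_def)
  have xS: "(x, y) \<in> S \<inter> R" using x(1) by (simp add: H_def)
  have "a < x" using x1 x(2)[of x1] by (auto simp: H_def)
  have row: "{a<..x} \<times> {y} \<subseteq> ?S1"
    using left_closed_row[OF assms(3)[unfolded R_def] xS[unfolded R_def]] \<open>a < x\<close> by auto
  have "(a, y) \<notin> ?S1" using \<open>y \<noteq> y'\<close> by auto
  with \<open>a < x\<close> row obtain m2 where m2: "line_move ?S1 m2" "fst m2 \<union> snd m2 \<subseteq> {a..x} \<times> {y}"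
      "snd m2 = (\<lambda>(x, y). (x - 1, y)) ` fst m2" "?S1 - fst m2 \<union> snd m2 = insert (a, y) (?S1 - {(x, y)})"
    by (rule hop_left)
  \<comment> \<open>The second move refills \<open>(a, y)\<close> from its row, so the net effect of
    both moves is that the node at \<open>(x, y)\<close> goes to \<open>(a, y')\<close>.\<close>
  let ?T = "insert (a, y') (S - {(x, y)})"
  have T: "insert (a, y) (?S1 - {(x, y)}) = ?T"
    using ay \<open>y \<noteq> y'\<close> \<open>a < x\<close> by auto
  have "line_moves S [m1, m2]" "result S [m1, m2] = ?T"
    using m1 m2 T by simp_all
  moreover have "confined R [m1, m2]"
  proof -
    have "{a} \<times> {min y y'..max y y'} \<subseteq> R" "{a..x} \<times> {y} \<subseteq> R"
      using xS y' by (auto simp: R_def rect_def)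
    then show ?thesis using subset_trans[OF m1(2)] subset_trans[OF m2(2)] by simp
  qed
  moreover have "left_closed R ?T"
    unfolding left_closed_def
  proof (intro allI impI)
    fix u z assume uz: "(u, z) \<in> ?T \<inter> R" "(u - 1, z) \<in> R"
    have "(u, z) \<noteq> (a, y')" using uz(2) by (auto simp: R_def rect_def)
    then have *: "(u, z) \<in> S \<inter> R" using uz by auto
    then have "(u - 1, z) \<in> S" using assms(3) uz(2) by (auto simp: left_closed_def)
    \<comment> \<open>Only the last node of row \<open>y\<close> has left, so no gap arises in that
      row.\<close>
    moreover have "(u - 1, z) \<noteq> (x, y)" using * x(2)[of u] by (auto simp: H_def)
    ultimately show "(u - 1, z) \<in> ?T" by auto
  qed
  moreover have "card (?T \<inter> col_line a b w) = Suc (card (S \<inter> col_line a b w))"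
  proof -
    have "?T \<inter> col_line a b w = insert (a, y') (S \<inter> col_line a b w)"
      using y'(1) \<open>a < x\<close> by (auto simp: R_def rect_def col_line_def)
    then show ?thesis using y'(2) by simp
  qed
  ultimately show ?thesis by (intro exI[of _ "[m1, m2]"]) simp
qed

text \<open>Repeating \<open>fill_hole\<close> stops when the first column is full or no node lies
  outside it. The inequality is a potential argument: two moves raise the count in the column by
  one.\<close>

lemma fill_holes:
  fixes a b :: int and v w :: nat
  defines "R \<equiv> rect a b v w"
  assumes "finite S" "left_closed R S" "v \<ge> 1"
  shows "\<exists>ms. line_moves S ms \<and> confined R ms \<and> left_closed R (result S ms) \<and>
    (col_line a b w \<subseteq> result S ms \<or> result S ms \<inter> R \<subseteq> col_line a b w) \<and>
    length ms + 2 * card (S \<inter> col_line a b w) \<le> 2 * card (result S ms \<inter> col_line a b w)"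
  using assms(2,3)
proof (induction "w - card (S \<inter> col_line a b w)" arbitrary: S rule: less_induct)
  case less
  show ?case
  proof (cases "col_line a b w \<subseteq> S \<or> S \<inter> R \<subseteq> col_line a b w")
    case True
    then show ?thesis using less by (intro exI[of _ "[]"]) auto
  next
    case False
    moreover have "col_line a b w \<subseteq> R" using assms(4) by (auto simp: col_line_def R_def rect_def)
    ultimately obtain y' where hole: "(a, y') \<in> R - S" by (auto simp: col_line_def)
    from False obtain x y where "(x, y) \<in> S \<inter> R" "(x, y) \<notin> col_line a b w" by auto
    then have extra: "(x, y) \<in> S \<inter> R" "x > a" by (auto simp: R_def rect_def col_line_def)
    obtain us where us: "line_moves S us" "confined R us" "left_closed R (result S us)"
        "card (result S us \<inter> col_line a b w) = Suc (card (S \<inter> col_line a b w))" "length us = 2"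
      using fill_hole[OF less.prems[unfolded R_def] hole[unfolded R_def] extra[unfolded R_def]]
      unfolding R_def by blast
    let ?S = "result S us"
    have fin: "finite ?S" using line_moves_card us(1) less.prems(1) by blast
    have "card (?S \<inter> col_line a b w) \<le> card (col_line a b w)" by (intro card_mono) auto
    then have "w - card (?S \<inter> col_line a b w) < w - card (S \<inter> col_line a b w)"
      using us(4) by simp
    from less.hyps[OF this fin us(3)] obtain vs where "line_moves ?S vs" "confined R vs"
        "left_closed R (result ?S vs)"
        "col_line a b w \<subseteq> result ?S vs \<or> result ?S vs \<inter> R \<subseteq> col_line a b w"
        "length vs + 2 * card (?S \<inter> col_line a b w) \<le> 2 * card (result ?S vs \<inter> col_line a b w)"
      by blast
    then show ?thesis using us by (intro exI[of _ "us @ vs"]) auto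
  qed
qed

lemma left_closed_mono:
  "left_closed R S \<Longrightarrow> R' \<subseteq> R \<Longrightarrow> left_closed R' S"
  by (auto simp: left_closed_def)

text \<open>Once the column is full nothing is left to do. Otherwise all nodes of \<open>R\<close>
  have been gathered in it, and if there are any, up to \<open>w\<close> more moves push them to the
  bottom. The surcharge thus belongs to the incomplete column alone.\<close>

lemma fill_column_exists:
  fixes a b :: int and v w :: nat
  defines "R \<equiv> rect a b (Suc v) w"
  assumes "finite S" "left_closed R S"
  shows "\<exists>ms. line_moves S ms \<and> confined R ms \<and>
    result S ms \<inter> col_line a b w = col_line a b (min w (card (S \<inter> R))) \<and>
    left_closed (rect (a + 1) b v w) (result S ms) \<and>
    length ms \<le> 2 * min w (card (S \<inter> R)) + (if 0 < card (S \<inter> R) \<and> card (S \<inter> R) < w then w else 0)"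
proof -
  let ?C = "col_line a b w" and ?R = "rect (a + 1) b v w" and ?m = "card (S \<inter> R)"
  have R: "R = ?C \<union> ?R" "?R \<inter> ?C = {}" by (auto simp: R_def rect_def col_line_def)
  obtain us where us: "line_moves S us" "confined R us" "left_closed R (result S us)"
      "?C \<subseteq> result S us \<or> result S us \<inter> R \<subseteq> ?C"
      "length us + 2 * card (S \<inter> ?C) \<le> 2 * card (result S us \<inter> ?C)"
    using fill_holes[of S a b "Suc v" w] assms unfolding R_def by auto
  let ?S = "result S us"
  have fin: "finite ?S" using line_moves_card us(1) assms(2) by blast
  have m: "card (?S \<inter> R) = ?m" using confined_card[OF us(1) assms(2) us(2)] .
  have le: "card (?S \<inter> ?C) \<le> ?m" unfolding m[symmetric] using fin R by (intro card_mono) auto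
  show ?thesis
  proof (cases "?C \<subseteq> ?S")
    case True
    then have C: "?S \<inter> ?C = ?C" by blast
    then have "w \<le> ?m" using le by simp
    then show ?thesis
      using us C left_closed_mono[OF us(3), of ?R] R by (intro exI[of _ us]) (auto simp: min_def)
  next
    case False
    then have sub: "?S \<inter> R \<subseteq> ?C" using us(4) by blast
    then have eq: "?S \<inter> ?C = ?S \<inter> R" using R by blast
    have "?S \<inter> ?C \<subset> ?C" using False by blast
    then have "card (?S \<inter> ?C) < w" using psubset_card_mono[of ?C] by simp
    then have less: "?m < w" using m eq by simp
    show ?thesis
    proof (cases "?m = 0")
      case True
      then have "?S \<inter> R = {}" using m fin by simp
      then have "?S \<inter> ?C = {}" "left_closed ?R ?S" using R by (auto simp: left_closed_def)
      then show ?thesis using us True by (intro exI[of _ us]) auto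
    next
      case False
      obtain vs where vs: "line_moves ?S vs" "confined ?C vs"
          "result ?S vs \<inter> ?C = col_line a b (card (?S \<inter> ?C))" "length vs \<le> w"
        using compact_col[OF fin] by blast
      have "result ?S vs \<inter> ?R = ?S \<inter> ?R" using result_disjoint[OF vs(2) R(2)] .
      also have "\<dots> = {}" using sub R by blast
      finally have "left_closed ?R (result ?S vs)" by (auto simp: left_closed_def)
      then show ?thesis
        using us vs eq m less False confined_mono[OF vs(2), of R] R
        by (intro exI[of _ "us @ vs"]) auto
    qed
  qed
qed

text \<open>Two facts are carried along with the cost. The bound with \<open>fst\<close> is the
  counting form of "at most one nonempty column is incomplete", from which the next phase starts.
  That at most \<open>w\<close> nodes end as a single line is what the last phase delivers.\<close>

lemma fill_columns_exist:
  assumes "finite S" "left_closed (rect (fst c + int j) (snd c) v w) S" "j + v = w"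
  shows "\<exists>ms. line_moves S ms \<and> confined (rect (fst c + int j) (snd c) v w) ms \<and>
    staged (fill_column c w) [j..<w] S ms \<and>
    length ms \<le> 2 * card (S \<inter> rect (fst c + int j) (snd c) v w) +
      (if S \<inter> rect (fst c + int j) (snd c) v w = {} then 0 else w) \<and>
    w * card (fst ` (result S ms \<inter> rect (fst c + int j) (snd c) v w)) \<le>
      card (S \<inter> rect (fst c + int j) (snd c) v w) + w \<and>
    (card (S \<inter> rect (fst c + int j) (snd c) v w) \<le> w \<longrightarrow>
      result S ms \<inter> rect (fst c + int j) (snd c) v w =
        col_line (fst c + int j) (snd c) (card (S \<inter> rect (fst c + int j) (snd c) v w)))"
  using assms
proof (induction v arbitrary: j S)
  case 0
  then show ?case by (intro exI[of _ "[]"]) (auto simp: rect_def)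
next
  case (Suc v)
  let ?a = "fst c + int j"
  let ?R = "rect ?a (snd c) (Suc v) w" and ?C = "col_line ?a (snd c) w"
  let ?R' = "rect (?a + 1) (snd c) v w"
  let ?m = "card (S \<inter> ?R)"
  have R: "?R = ?C \<union> ?R'" "?C \<inter> ?R' = {}" by (auto simp: rect_def col_line_def)
  obtain us where us: "line_moves S us" "confined ?R us"
      "result S us \<inter> ?C = col_line ?a (snd c) (min w ?m)" "left_closed ?R' (result S us)"
      "length us \<le> 2 * min w ?m + (if 0 < ?m \<and> ?m < w then w else 0)"
    using fill_column_exists[OF Suc.prems(1,2)] by blast
  let ?S = "result S us"
  let ?m' = "card (?S \<inter> ?R')"
  have fin: "finite ?S" using line_moves_card us(1) Suc.prems(1) by blast
  have "?m = card (?S \<inter> ?R)" using confined_card[OF us(1) Suc.prems(1) us(2)] ..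
  also have "?S \<inter> ?R = (?S \<inter> ?C) \<union> (?S \<inter> ?R')" using R by blast
  also have "card \<dots> = card (?S \<inter> ?C) + ?m'" using R fin by (intro card_Un_disjoint) auto
  finally have m: "?m = min w ?m + ?m'" using us(3) by simp
  have shift: "fst c + int (Suc j) = ?a + 1" by simp
  obtain vs where vs: "line_moves ?S vs" "confined ?R' vs" "staged (fill_column c w) [Suc j..<w] ?S vs"
      "length vs \<le> 2 * ?m' + (if ?S \<inter> ?R' = {} then 0 else w)"
      "w * card (fst ` (result ?S vs \<inter> ?R')) \<le> ?m' + w"
      "?m' \<le> w \<Longrightarrow> result ?S vs \<inter> ?R' = col_line (?a + 1) (snd c) ?m'"
    using Suc.IH[of ?S "Suc j"] fin us(4) Suc.prems(3) unfolding shift by auto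
  let ?T = "result ?S vs"
  have C: "?T \<inter> ?C = col_line ?a (snd c) (min w ?m)"
    using result_disjoint[OF vs(2) R(2)] us(3) by simp
  have T: "?T \<inter> ?R = col_line ?a (snd c) (min w ?m) \<union> (?T \<inter> ?R')"
    using R C by blast
  have "?R = {fst c + int j..<fst c + int w} \<times> {snd c..<snd c + int w}"
    using Suc.prems(3) by (auto simp: rect_def)
  then have "fill_column c w j S us"
    using us(2,3) by (simp add: fill_column_def confined_def Let_def)
  moreover have "[j..<w] = j # [Suc j..<w]" using Suc.prems(3) by (simp add: upt_conv_Cons)
  ultimately have "staged (fill_column c w) [j..<w] S (us @ vs)" using vs(3) by auto
  moreover have "confined ?R (us @ vs)" using us(2) confined_mono[OF vs(2), of ?R] R by simp
  \<comment> \<open>The surcharge \<open>w\<close> is paid at most once: if the first column pays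
    it, then \<open>?m < w\<close> and no node remains for the others.\<close>
  moreover have "length (us @ vs) \<le> 2 * ?m + (if S \<inter> ?R = {} then 0 else w)"
  proof -
    have "?S \<inter> ?R' = {} \<longleftrightarrow> ?m' = 0" "S \<inter> ?R = {} \<longleftrightarrow> ?m = 0"
      using fin Suc.prems(1) by simp_all
    then show ?thesis using us(5) vs(4) m by (auto simp: min_def split: if_splits)
  qed
  moreover have "w * card (fst ` (?T \<inter> ?R)) \<le> ?m + w"
  proof -
    have "fst ` (?T \<inter> ?R) \<subseteq> insert ?a (fst ` (?T \<inter> ?R'))"
      unfolding T by (auto simp: col_line_def)
    moreover have "finite (fst ` (?T \<inter> ?R'))" by (auto simp: rect_def)
    ultimately have "card (fst ` (?T \<inter> ?R)) \<le> card (insert ?a (fst ` (?T \<inter> ?R')))"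
      by (intro card_mono) auto
    also have "\<dots> \<le> Suc (card (fst ` (?T \<inter> ?R')))" by (rule card_insert_le_m1) auto
    finally have 1: "card (fst ` (?T \<inter> ?R)) \<le> Suc (card (fst ` (?T \<inter> ?R')))" .
    show ?thesis
    proof (cases "w \<le> ?m")
      case True
      then have "w * card (fst ` (?T \<inter> ?R)) \<le> w + w * card (fst ` (?T \<inter> ?R'))"
        using mult_le_mono2[OF 1, of w] by simp
      also have "\<dots> \<le> ?m + w" using vs(5) m True by (simp add: min_def)
      finally show ?thesis .
    next
      case False
      \<comment> \<open>With fewer than \<open>w\<close> nodes the first column takes them
        all.\<close>
      then have "?T \<inter> ?R' = {}" using vs(6) m by (simp add: min_def)
      then have "w * card (fst ` (?T \<inter> ?R)) \<le> w" using mult_le_mono2[OF 1, of w] by simp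
      then show ?thesis by (rule trans_le_add2)
    qed
  qed
  moreover have "?T \<inter> ?R = col_line ?a (snd c) ?m" if "?m \<le> w"
  proof -
    have "min w ?m = ?m" using that by simp
    then have "?m' = 0" using m by linarith
    then have "?T \<inter> ?R' = {}" using vs(6) by simp
    then show ?thesis unfolding T \<open>min w ?m = ?m\<close> by simp
  qed
  ultimately show ?case using us(1) vs(1) by (intro exI[of _ "us @ vs"]) auto
qed

text \<open>The hypothesis limits the number of nonempty rows, so for \<open>m\<close> nodes pushing
  left costs at most \<open>2 m + 4 w\<close> moves; filling adds \<open>2 m + w\<close>. Their sum
  is the origin of \<open>4 m + 5 w\<close>.\<close>

lemma rows_to_columns_exists:
  assumes "finite S" "w * card (snd ` (S \<inter> sq_box c w)) \<le> 2 * card (S \<inter> sq_box c w) + 4 * w"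
  shows "\<exists>ms. line_moves S ms \<and> confined (sq_box c w) ms \<and> rows_to_columns c w S ms \<and>
    length ms \<le> (if S \<inter> sq_box c w = {} then 0 else 4 * card (S \<inter> sq_box c w) + 5 * w) \<and>
    w * card (fst ` (result S ms \<inter> sq_box c w)) \<le> card (S \<inter> sq_box c w) + w \<and>
    (card (S \<inter> sq_box c w) \<le> w \<longrightarrow>
      result S ms \<inter> sq_box c w = col_line (fst c) (snd c) (card (S \<inter> sq_box c w)))"
proof -
  let ?B = "sq_box c w"
  have B: "?B = rect (fst c + int 0) (snd c) w w" by (simp add: sq_box_def rect_def)
  obtain us where us: "line_moves S us" "confined ?B us" "push_left c w S us"
      "length us \<le> w * card (snd ` (S \<inter> ?B))"
    using push_left_exists[OF assms(1)] by blast
  let ?S = "result S us"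
  have fin: "finite ?S" using line_moves_card us(1) assms(1) by blast
  have m: "card (?S \<inter> ?B) = card (S \<inter> ?B)" using confined_card[OF us(1) assms(1) us(2)] .
  have empty: "?S \<inter> ?B = {} \<longleftrightarrow> S \<inter> ?B = {}"
    using m fin assms(1) by (metis card_0_eq finite_Int)
  have "left_closed ?B ?S"
    unfolding left_closed_def
  proof (intro allI impI)
    fix x y assume xy: "(x, y) \<in> ?S \<inter> ?B" "(x - 1, y) \<in> ?B"
    then obtain k where k: "?S \<inter> row_line (fst c) y w = row_line (fst c) y k"
      using us(3) unfolding push_left_def sq_box_def by (metis IntD2 SigmaD2)
    have "(x, y) \<in> row_line (fst c) y k" using xy by (subst k[symmetric]) (auto simp: sq_box_def row_line_def)
    then have "(x - 1, y) \<in> row_line (fst c) y k" using xy by (auto simp: row_line_def sq_box_def)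
    then show "(x - 1, y) \<in> ?S" using k by blast
  qed
  then obtain vs where vs: "line_moves ?S vs" "confined ?B vs" "staged (fill_column c w) [0..<w] ?S vs"
      "length vs \<le> 2 * card (?S \<inter> ?B) + (if ?S \<inter> ?B = {} then 0 else w)"
      "w * card (fst ` (result ?S vs \<inter> ?B)) \<le> card (?S \<inter> ?B) + w"
      "card (?S \<inter> ?B) \<le> w \<longrightarrow> result ?S vs \<inter> ?B = col_line (fst c + int 0) (snd c) (card (?S \<inter> ?B))"
    using fill_columns_exist[of ?S c 0 w w] fin unfolding B[symmetric] by auto
  have "rows_to_columns c w S (us @ vs)"
    using us(3) vs(3) by (auto simp: rows_to_columns_def)
  moreover have "length (us @ vs) \<le> (if S \<inter> ?B = {} then 0 else 4 * card (S \<inter> ?B) + 5 * w)"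
    using us(4) vs(4) assms(2) m empty by (cases "S \<inter> ?B = {}") auto
  ultimately show ?thesis
    using us(1,2) vs m by (intro exI[of _ "us @ vs"]) auto
qed

lemma swap_sq_box: "prod.swap ` sq_box c w = sq_box (prod.swap c) w"
  by (auto simp: sq_box_def image_iff)

text \<open>Everything is conjugated by \<open>prod.swap\<close>, which exchanges the
  \<open>fst\<close> and \<open>snd\<close> images and thereby the two kinds of nonempty
  lines.\<close>

lemma columns_to_rows_exists:
  assumes "finite S" "w * card (fst ` (S \<inter> sq_box c w)) \<le> 2 * card (S \<inter> sq_box c w) + 4 * w"
  shows "\<exists>ms. line_moves S ms \<and> confined (sq_box c w) ms \<and> columns_to_rows c w S ms \<and>
    length ms \<le> (if S \<inter> sq_box c w = {} then 0 else 4 * card (S \<inter> sq_box c w) + 5 * w) \<and>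
    w * card (snd ` (result S ms \<inter> sq_box c w)) \<le> card (S \<inter> sq_box c w) + w \<and>
    (card (S \<inter> sq_box c w) \<le> w \<longrightarrow>
      result S ms \<inter> sq_box c w = row_line (fst c) (snd c) (card (S \<inter> sq_box c w)))"
proof -
  let ?S = "prod.swap ` S" and ?c = "prod.swap c"
  have swap: "X \<inter> sq_box ?c w = prod.swap ` (prod.swap ` X \<inter> sq_box c w)" for X
    by (simp add: image_Int swap_sq_box image_image)
  have card: "card (?S \<inter> sq_box ?c w) = card (S \<inter> sq_box c w)"
    unfolding swap by (simp add: card_image image_image)
  have img: "fst ` (X \<inter> sq_box ?c w) = snd ` (prod.swap ` X \<inter> sq_box c w)"
      "snd ` (X \<inter> sq_box ?c w) = fst ` (prod.swap ` X \<inter> sq_box c w)" for X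
    unfolding swap by (simp_all add: image_image)
  have emp: "?S \<inter> sq_box ?c w = {} \<longleftrightarrow> S \<inter> sq_box c w = {}"
    unfolding swap by (simp add: image_image)
  have "w * card (snd ` (?S \<inter> sq_box ?c w)) \<le> 2 * card (?S \<inter> sq_box ?c w) + 4 * w"
    using assms(2) unfolding img card by (simp add: image_image)
  then obtain ms where ms: "line_moves ?S ms" "confined (sq_box ?c w) ms" "rows_to_columns ?c w ?S ms"
    "length ms \<le> (if S \<inter> sq_box c w = {} then 0 else 4 * card (S \<inter> sq_box c w) + 5 * w)"
    "w * card (snd ` (prod.swap ` result ?S ms \<inter> sq_box c w)) \<le> card (S \<inter> sq_box c w) + w"
    "card (S \<inter> sq_box c w) \<le> w \<Longrightarrow>
      result ?S ms \<inter> sq_box ?c w = col_line (snd c) (fst c) (card (S \<inter> sq_box c w))"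
    using rows_to_columns_exists[of ?S w ?c] assms(1) unfolding card img emp by auto
  let ?ms = "map_moves prod.swap ms"
  have res: "result S ?ms = prod.swap ` result ?S ms"
    using result_swap[of ?S ms] by (simp add: image_image)
  have "line_moves S ?ms" using line_moves_swap[OF ms(1)] by (simp add: image_image)
  moreover have "confined (sq_box c w) ?ms"
    using confined_map_moves[OF ms(2), of prod.swap] by (simp add: swap_sq_box)
  moreover have "columns_to_rows c w S ?ms" using ms(3) by (simp add: columns_to_rows_def)
  moreover have "result S ?ms \<inter> sq_box c w = row_line (fst c) (snd c) (card (S \<inter> sq_box c w))"
    if "card (S \<inter> sq_box c w) \<le> w"
  proof -
    have "result S ?ms \<inter> sq_box c w = prod.swap ` (result ?S ms \<inter> sq_box ?c w)"
      unfolding swap res by (simp add: image_image)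
    then show ?thesis using ms(6)[OF that] by simp
  qed
  ultimately show ?thesis using ms(4,5) unfolding res[symmetric]
    by (intro exI[of _ ?ms]) auto
qed

text \<open>The number of nonempty lines in the direction of the moves that open phase \<open>i\<close>: rows are
  pushed left if \<open>i\<close> is odd, columns are pushed down if \<open>i\<close> is even.\<close>

definition breadth :: "nat \<Rightarrow> shape \<Rightarrow> nat" where
  "breadth i T = card ((if odd i then snd else fst) ` T)"

text \<open>The parity of the last phase fixes the direction of the line. Two shapes of equal order
  run equally many phases and so end in the same direction.\<close>

definition final_line :: "nat \<Rightarrow> cell \<Rightarrow> nat \<Rightarrow> shape" where
  "final_line i c k = (if odd i then col_line (fst c) (snd c) k else row_line (fst c) (snd c) k)"

text \<open>A phase consumes a bound on the lines of one direction and produces a sharper one for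
  the other direction, hence \<open>breadth i\<close> before and \<open>breadth (Suc i)\<close>
  after. Empty boxes must cost nothing, as a phase visits all sub-boxes.\<close>

lemma box_phase_exists:
  assumes "finite S" "w * breadth i (S \<inter> sq_box c w) \<le> 2 * card (S \<inter> sq_box c w) + 4 * w"
  shows "\<exists>ms. line_moves S ms \<and> confined (sq_box c w) ms \<and>
    (if odd i then rows_to_columns c w else columns_to_rows c w) S ms \<and>
    (w * breadth (Suc i) (result S ms \<inter> sq_box c w) \<le> card (S \<inter> sq_box c w) + w \<and>
     card (result S ms \<inter> sq_box c w) = card (S \<inter> sq_box c w) \<and>
     (card (S \<inter> sq_box c w) \<le> w \<longrightarrow>
      result S ms \<inter> sq_box c w = final_line i c (card (S \<inter> sq_box c w)))) \<and>
    length ms \<le> (if S \<inter> sq_box c w = {} then 0 else 4 * card (S \<inter> sq_box c w) + 5 * w)"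
proof (cases "odd i")
  case True
  then obtain ms where "line_moves S ms" "confined (sq_box c w) ms" "rows_to_columns c w S ms"
    "length ms \<le> (if S \<inter> sq_box c w = {} then 0 else 4 * card (S \<inter> sq_box c w) + 5 * w)"
    "w * card (fst ` (result S ms \<inter> sq_box c w)) \<le> card (S \<inter> sq_box c w) + w"
    "card (S \<inter> sq_box c w) \<le> w \<longrightarrow>
      result S ms \<inter> sq_box c w = col_line (fst c) (snd c) (card (S \<inter> sq_box c w))"
    using rows_to_columns_exists[of S w c] assms unfolding breadth_def by auto
  then show ?thesis using True confined_card[OF _ assms(1)]
    unfolding breadth_def final_line_def by (intro exI[of _ ms]) simp
next
  case False
  then obtain ms where "line_moves S ms" "confined (sq_box c w) ms" "columns_to_rows c w S ms"
    "length ms \<le> (if S \<inter> sq_box c w = {} then 0 else 4 * card (S \<inter> sq_box c w) + 5 * w)"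
    "w * card (snd ` (result S ms \<inter> sq_box c w)) \<le> card (S \<inter> sq_box c w) + w"
    "card (S \<inter> sq_box c w) \<le> w \<longrightarrow>
      result S ms \<inter> sq_box c w = row_line (fst c) (snd c) (card (S \<inter> sq_box c w))"
    using columns_to_rows_exists[of S w c] assms unfolding breadth_def by auto
  then show ?thesis using False confined_card[OF _ assms(1)]
    unfolding breadth_def final_line_def by (intro exI[of _ ms]) simp
qed

section \<open>Phases\<close>

text \<open>A grid on the whole plane instead of a set of sub-boxes: the occupied boxes become an
  image of the shape, which can be counted along a walk and compared between scales.\<close>

definition box_index :: "cell \<Rightarrow> nat \<Rightarrow> cell \<Rightarrow> int \<times> int" where
  "box_index c w p = ((fst p - fst c) div int w, (snd p - snd c) div int w)"

lemma int_div_eq_iff: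
  fixes a p w :: int
  assumes "w > 0"
  shows "a div w = p \<longleftrightarrow> p * w \<le> a \<and> a < p * w + w"
proof
  assume "a div w = p"
  then have "a = p * w + a mod w" using div_mult_mod_eq[of a w] by simp
  then show "p * w \<le> a \<and> a < p * w + w"
    using pos_mod_bound[OF assms, of a] pos_mod_sign[OF assms, of a] by linarith
next
  assume "p * w \<le> a \<and> a < p * w + w"
  then show "a div w = p"
    by (intro int_div_pos_eq[of a w p "a - p * w"]) (auto simp: mult.commute)
qed

lemma mem_sub_box_iff:
  assumes "w > 0"
  shows "z \<in> sq_box (fst c + p * int w, snd c + q * int w) w \<longleftrightarrow> box_index c w z = (p, q)"
  using assms by (cases z) (auto simp: box_index_def int_div_eq_iff sq_box_def)

lemma sub_boxes_cover:
  assumes "z \<in> sq_box c (2 ^ d)" "i \<le> d"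
  shows "\<exists>b\<in>sub_boxes c d i. z \<in> sq_box b (2 ^ i)"
proof -
  let ?w = "2 ^ i :: nat"
  have w: "?w > 0" by simp
  have pow: "(2::int) ^ d = 2 ^ (d - i) * 2 ^ i" using assms(2) by (simp flip: power_add)
  obtain p q where pq: "box_index c ?w z = (p, q)" by fastforce
  have bounds: "0 \<le> u div 2 ^ i \<and> u div 2 ^ i < 2 ^ (d - i)" if "0 \<le> u" "u < 2 ^ d" for u :: int
  proof -
    have "u div 2 ^ i * 2 ^ i \<le> u" using int_div_eq_iff[of "2 ^ i" u "u div 2 ^ i"] by simp
    then have "u div 2 ^ i * 2 ^ i < 2 ^ (d - i) * 2 ^ i" using that pow by linarith
    then have "u div 2 ^ i < 2 ^ (d - i)" by (rule mult_right_less_imp_less) simp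
    then show ?thesis using that by (simp add: pos_imp_zdiv_nonneg_iff)
  qed
  have "0 \<le> p" "0 \<le> q" "p < 2 ^ (d - i)" "q < 2 ^ (d - i)"
    using assms(1) pq bounds[of "fst z - fst c"] bounds[of "snd z - snd c"]
    by (auto simp: box_index_def sq_box_def)
  then have "nat p < 2 ^ (d - i)" "nat q < 2 ^ (d - i)" "int (nat p) = p" "int (nat q) = q"
    by (simp_all add: nat_less_iff)
  then have "(fst c + p * 2 ^ i, snd c + q * 2 ^ i) \<in> sub_boxes c d i"
    unfolding sub_boxes_def by (intro CollectI exI[of _ "nat p"] exI[of _ "nat q"]) simp
  moreover have "z \<in> sq_box (fst c + p * 2 ^ i, snd c + q * 2 ^ i) ?w"
    using mem_sub_box_iff[OF w, of z c p q] pq by simp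
  ultimately show ?thesis by blast
qed

lemma sub_boxes_index:
  assumes "b \<in> sub_boxes c d i"
  shows "\<exists>p q. b = (fst c + p * int (2 ^ i), snd c + q * int (2 ^ i)) \<and>
    (\<forall>z. z \<in> sq_box b (2 ^ i) \<longleftrightarrow> box_index c (2 ^ i) z = (p, q))"
proof -
  obtain p q where b: "b = (fst c + int p * int (2 ^ i), snd c + int q * int (2 ^ i))"
    using assms by (auto simp: sub_boxes_def)
  show ?thesis unfolding b
    using mem_sub_box_iff[of "2 ^ i" _ c "int p" "int q"] by (intro exI[of _ "int p"] exI[of _ "int q"]) simp
qed

lemma sub_boxes_inside:
  assumes "b \<in> sub_boxes c d i" "i \<le> d"
  shows "sq_box b (2 ^ i) \<subseteq> sq_box c (2 ^ d)"
proof -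
  obtain p q where b: "b = (fst c + int p * 2 ^ i, snd c + int q * 2 ^ i)"
      "p < 2 ^ (d - i)" "q < 2 ^ (d - i)"
    using assms(1) by (auto simp: sub_boxes_def)
  have "int p * 2 ^ i + 2 ^ i \<le> 2 ^ d" if "p < 2 ^ (d - i)" for p
  proof -
    have "int p + 1 \<le> 2 ^ (d - i)" using that by (metis add.commute of_nat_1 of_nat_add of_nat_le_iff of_nat_numeral of_nat_power plus_1_eq_Suc Suc_leI)
    then have "(int p + 1) * 2 ^ i \<le> 2 ^ (d - i) * 2 ^ i" by (intro mult_right_mono) auto
    also have "\<dots> = 2 ^ d" using assms(2) by (simp flip: power_add)
    finally show ?thesis by (simp add: algebra_simps)
  qed
  note upper = this[OF b(2)] this[OF b(3)]
  define u v where "u = int p * 2 ^ i" and "v = int q * 2 ^ i"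
  have "0 \<le> u" "0 \<le> v" by (simp_all add: u_def v_def)
  then show ?thesis
    using upper unfolding b(1) sq_box_def u_def[symmetric] v_def[symmetric] by auto
qed

lemma finite_sub_boxes [simp]: "finite (sub_boxes c d i)"
proof -
  have "sub_boxes c d i \<subseteq> (\<lambda>(p, q). (fst c + int p * 2 ^ i, snd c + int q * 2 ^ i)) ` ({..<2 ^ (d - i)} \<times> {..<2 ^ (d - i)})"
    by (auto simp: sub_boxes_def)
  then show ?thesis by (rule finite_subset) auto
qed

lemma sub_boxes_disjoint:
  assumes "b \<in> sub_boxes c d i" "b' \<in> sub_boxes c d i" "b \<noteq> b'"
  shows "sq_box b (2 ^ i) \<inter> sq_box b' (2 ^ i) = {}"
proof -
  obtain p q where b: "b = (fst c + p * int (2 ^ i), snd c + q * int (2 ^ i))"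
      "\<forall>z. z \<in> sq_box b (2 ^ i) \<longleftrightarrow> box_index c (2 ^ i) z = (p, q)"
    using sub_boxes_index[OF assms(1)] by blast
  obtain p' q' where b': "b' = (fst c + p' * int (2 ^ i), snd c + q' * int (2 ^ i))"
      "\<forall>z. z \<in> sq_box b' (2 ^ i) \<longleftrightarrow> box_index c (2 ^ i) z = (p', q')"
    using sub_boxes_index[OF assms(2)] by blast
  have "(p, q) \<noteq> (p', q')" using assms(3) b(1) b'(1) by auto
  then show ?thesis using b(2) b'(2) by auto
qed

text \<open>Applied in both directions, it shows that two shapes occupying the same sub-boxes have
  the same set of indices.\<close>

lemma box_index_image_mono:
  assumes "S \<subseteq> sq_box c (2 ^ d)" "i \<le> d"
    and "\<And>b. b \<in> sub_boxes c d i \<Longrightarrow> S \<inter> sq_box b (2 ^ i) \<noteq> {} \<Longrightarrow> T \<inter> sq_box b (2 ^ i) \<noteq> {}"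
  shows "box_index c (2 ^ i) ` S \<subseteq> box_index c (2 ^ i) ` T"
proof
  fix u assume "u \<in> box_index c (2 ^ i) ` S"
  then obtain z where z: "z \<in> S" "u = box_index c (2 ^ i) z" by blast
  then obtain b where b: "b \<in> sub_boxes c d i" "z \<in> sq_box b (2 ^ i)"
    using sub_boxes_cover[of z c d i] assms by blast
  then obtain z' where "z' \<in> T" "z' \<in> sq_box b (2 ^ i)" using assms(3)[OF b(1)] z(1) by blast
  then show "u \<in> box_index c (2 ^ i) ` T"
    using sub_boxes_index[OF b(1)] b(2) z(2) by (metis imageI)
qed

lemma card_occupied:
  assumes "finite S"
  shows "card {b \<in> sub_boxes c d i. S \<inter> sq_box b (2 ^ i) \<noteq> {}} \<le> card (box_index c (2 ^ i) ` S)"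
proof -
  let ?g = "\<lambda>(p, q). (fst c + p * int (2 ^ i), snd c + q * int (2 ^ i))"
  have "{b \<in> sub_boxes c d i. S \<inter> sq_box b (2 ^ i) \<noteq> {}} \<subseteq> ?g ` (box_index c (2 ^ i) ` S)"
  proof clarify
    fix x y assume b: "(x, y) \<in> sub_boxes c d i" "S \<inter> sq_box (x, y) (2 ^ i) \<noteq> {}"
    obtain p q where pq: "(x, y) = (fst c + p * int (2 ^ i), snd c + q * int (2 ^ i))"
      "\<forall>z. z \<in> sq_box (x, y) (2 ^ i) \<longleftrightarrow> box_index c (2 ^ i) z = (p, q)"
      using sub_boxes_index[OF b(1)] by blast
    then have "(p, q) \<in> box_index c (2 ^ i) ` S" using b(2) by (force simp: image_iff)
    then have "?g (p, q) \<in> ?g ` (box_index c (2 ^ i) ` S)" by (rule imageI)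
    then show "(x, y) \<in> ?g ` (box_index c (2 ^ i) ` S)" using pq(1) by simp
  qed
  then have "card {b \<in> sub_boxes c d i. S \<inter> sq_box b (2 ^ i) \<noteq> {}} \<le> card (?g ` (box_index c (2 ^ i) ` S))"
    using assms by (intro card_mono) auto
  also have "\<dots> \<le> card (box_index c (2 ^ i) ` S)" using assms by (intro card_image_le) auto
  finally show ?thesis .
qed

text \<open>The terms \<open>4 m\<close> of the occupied boxes add up to at most
  \<open>4 * card S\<close>, and the surcharge \<open>5 * 2 ^ i\<close> is paid once per occupied
  box. Since each box keeps its number of nodes, the occupied boxes stay the same.\<close>

lemma phase_exists:
  assumes "finite S" "S \<subseteq> sq_box c (2 ^ d)" "i \<le> d"
    and "\<And>b. b \<in> sub_boxes c d i \<Longrightarrow>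
      2 ^ i * breadth i (S \<inter> sq_box b (2 ^ i)) \<le> 2 * card (S \<inter> sq_box b (2 ^ i)) + 4 * 2 ^ i"
  shows "\<exists>ms. line_moves S ms \<and> confined (sq_box c (2 ^ d)) ms \<and> ubox_phase c d i S ms \<and>
    length ms \<le> 4 * card S + 5 * 2 ^ i * card (box_index c (2 ^ i) ` S) \<and>
    box_index c (2 ^ i) ` result S ms = box_index c (2 ^ i) ` S \<and>
    (\<forall>b\<in>sub_boxes c d i.
      2 ^ i * breadth (Suc i) (result S ms \<inter> sq_box b (2 ^ i)) \<le> card (result S ms \<inter> sq_box b (2 ^ i)) + 2 ^ i \<and>
      card (result S ms \<inter> sq_box b (2 ^ i)) = card (S \<inter> sq_box b (2 ^ i)) \<and>
      (card (S \<inter> sq_box b (2 ^ i)) \<le> 2 ^ i \<longrightarrow>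
        result S ms \<inter> sq_box b (2 ^ i) = final_line i b (card (S \<inter> sq_box b (2 ^ i)))))"
proof -
  let ?w = "2 ^ i :: nat"
  let ?R = "\<lambda>b. sq_box b ?w"
  let ?f = "\<lambda>b. if S \<inter> ?R b = {} then 0 else 4 * card (S \<inter> ?R b) + 5 * ?w"
  let ?Q = "\<lambda>b X. ?w * breadth (Suc i) X \<le> card (S \<inter> ?R b) + ?w \<and> card X = card (S \<inter> ?R b) \<and>
     (card (S \<inter> ?R b) \<le> ?w \<longrightarrow> X = final_line i b (card (S \<inter> ?R b)))"
  let ?P = "\<lambda>b. if odd i then rows_to_columns b ?w else columns_to_rows b ?w"
  obtain bs where bs: "distinct bs" "set bs = sub_boxes c d i"
    using finite_distinct_list[OF finite_sub_boxes] by blast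
  have "\<exists>ms. line_moves S ms \<and> confined (\<Union>b\<in>set bs. ?R b) ms \<and> staged ?P bs S ms \<and>
    (\<forall>b\<in>set bs. ?Q b (result S ms \<inter> ?R b)) \<and> length ms \<le> (\<Sum>b\<in>set bs. ?f b)"
  proof (rule staged_local[OF bs(1) assms(1)])
    show "?R b \<inter> ?R b' = {}" if "b \<in> set bs" "b' \<in> set bs" "b \<noteq> b'" for b b'
      using that sub_boxes_disjoint unfolding bs(2) by blast
    show "\<exists>us. line_moves T us \<and> confined (?R b) us \<and> ?P b T us \<and> ?Q b (result T us \<inter> ?R b) \<and>
        length us \<le> ?f b"
      if "b \<in> set bs" "finite T" "T \<inter> ?R b = S \<inter> ?R b" for b T
      using box_phase_exists[of T ?w i b] assms(4)[of b] that unfolding bs(2) that(3) by blast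
  qed
  then obtain ms where ms: "line_moves S ms" "confined (\<Union>b\<in>set bs. ?R b) ms" "staged ?P bs S ms"
      "\<forall>b\<in>set bs. ?Q b (result S ms \<inter> ?R b)" "length ms \<le> (\<Sum>b\<in>set bs. ?f b)"
    by blast
  let ?T = "result S ms"
  have fin: "finite ?T" using line_moves_card ms(1) assms(1) by blast
  have conf: "confined (sq_box c (2 ^ d)) ms"
    using sub_boxes_inside[OF _ assms(3)] bs(2)
    by (intro confined_mono[OF ms(2)] UN_least) simp
  have T: "?T \<subseteq> sq_box c (2 ^ d)" using result_minus[OF conf, of S] assms(2) by blast
  have occ: "S \<inter> ?R b = {} \<longleftrightarrow> ?T \<inter> ?R b = {}" if "b \<in> sub_boxes c d i" for b
  proof -
    have "card (?T \<inter> ?R b) = card (S \<inter> ?R b)" using ms(4) that bs(2) by simp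
    moreover have "finite (?T \<inter> ?R b)" "finite (S \<inter> ?R b)" using fin assms(1) by simp_all
    ultimately show ?thesis by (metis card_0_eq)
  qed
  have "box_index c ?w ` ?T = box_index c ?w ` S"
    using occ by (intro equalityI box_index_image_mono[OF T assms(3)] box_index_image_mono[OF assms(2,3)]) auto
  moreover have "(\<Sum>b\<in>set bs. ?f b) \<le> 4 * card S + 5 * ?w * card (box_index c ?w ` S)"
  proof -
    let ?O = "{b \<in> sub_boxes c d i. S \<inter> ?R b \<noteq> {}}"
    have "(\<Sum>b\<in>set bs. ?f b) = (\<Sum>b\<in>?O. 4 * card (S \<inter> ?R b) + 5 * ?w)"
      unfolding bs(2) by (rule sum.mono_neutral_cong_right) auto
    also have "\<dots> = 4 * (\<Sum>b\<in>?O. card (S \<inter> ?R b)) + 5 * ?w * card ?O"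
      by (simp add: sum.distrib sum_distrib_left)
    also have "(\<Sum>b\<in>?O. card (S \<inter> ?R b)) = card (\<Union>b\<in>?O. S \<inter> ?R b)"
    proof (rule card_UN_disjoint[symmetric])
      show "\<forall>b\<in>?O. \<forall>b'\<in>?O. b \<noteq> b' \<longrightarrow> (S \<inter> ?R b) \<inter> (S \<inter> ?R b') = {}"
        using sub_boxes_disjoint by blast
    qed (use assms(1) in auto)
    also have "\<dots> \<le> card S" using assms(1) by (intro card_mono) auto
    also have "card ?O \<le> card (box_index c ?w ` S)" using card_occupied[OF assms(1)] .
    finally show ?thesis by simp
  qed
  moreover have "ubox_phase c d i S ms"
    unfolding ubox_phase_def using bs ms(3) by blast
  ultimately show ?thesis
    using ms(1,4,5) conf unfolding bs(2) by (intro exI[of _ ms]) auto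
qed

section \<open>From one scale to the next\<close>

lemma breadth_Un: "breadth i (X \<union> Y) \<le> breadth i X + breadth i Y"
  unfolding breadth_def image_Un by (rule card_Un_le)

text \<open>With \<open>w = 2 ^ i\<close>, adding up the four quadrants gives
  \<open>w * breadth \<le> m + 4 w\<close>; doubling both sides restates it for side
  \<open>2 w\<close>. This is where the factor 2 before the number of nodes comes from.\<close>

lemma merge_boxes:
  assumes "finite T" "Suc i \<le> d" "b \<in> sub_boxes c d (Suc i)"
    and small: "\<And>b. b \<in> sub_boxes c d i \<Longrightarrow>
      2 ^ i * breadth j (T \<inter> sq_box b (2 ^ i)) \<le> card (T \<inter> sq_box b (2 ^ i)) + 2 ^ i"
  shows "2 ^ Suc i * breadth j (T \<inter> sq_box b (2 ^ Suc i)) \<le>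
    2 * card (T \<inter> sq_box b (2 ^ Suc i)) + 4 * 2 ^ Suc i"
proof -
  let ?w = "2 ^ i :: nat"
  obtain p q where b: "b = (fst c + int p * 2 ^ Suc i, snd c + int q * 2 ^ Suc i)"
      "p < 2 ^ (d - Suc i)" "q < 2 ^ (d - Suc i)"
    using assms(3) by (auto simp: sub_boxes_def)
  have pow: "(2::nat) ^ (d - i) = 2 * 2 ^ (d - Suc i)"
    using assms(2) by (metis Suc_diff_Suc Suc_le_eq power_Suc)
  have child: "(fst b + int e * 2 ^ i, snd b + int f * 2 ^ i) \<in> sub_boxes c d i" if "e < 2" "f < 2" for e f
  proof -
    have "(fst b + int e * 2 ^ i, snd b + int f * 2 ^ i) =
        (fst c + int (2 * p + e) * 2 ^ i, snd c + int (2 * q + f) * 2 ^ i)"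
      unfolding b(1) by (simp add: algebra_simps)
    moreover have "2 * p + e < 2 ^ (d - i)" "2 * q + f < 2 ^ (d - i)"
      using that b(2,3) pow by linarith+
    ultimately show ?thesis unfolding sub_boxes_def by blast
  qed
  let ?B = "\<lambda>e f. T \<inter> sq_box (fst b + int e * 2 ^ i, snd b + int f * 2 ^ i) ?w"
  have small': "?w * breadth j (?B e f) \<le> card (?B e f) + ?w" if "e < 2" "f < 2" for e f
    using small[OF child[OF that]] .
  have split: "T \<inter> sq_box b (2 ^ Suc i) = (?B 0 0 \<union> ?B 1 0) \<union> (?B 0 1 \<union> ?B 1 1)"
    by (auto simp: sq_box_def)
  have fin: "finite (?B e f)" for e f using assms(1) by simp
  have "card (T \<inter> sq_box b (2 ^ Suc i)) = card (?B 0 0 \<union> ?B 1 0) + card (?B 0 1 \<union> ?B 1 1)"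
    unfolding split using fin by (intro card_Un_disjoint) (auto simp: sq_box_def)
  also have "card (?B 0 0 \<union> ?B 1 0) = card (?B 0 0) + card (?B 1 0)"
    using fin by (intro card_Un_disjoint) (auto simp: sq_box_def)
  also have "card (?B 0 1 \<union> ?B 1 1) = card (?B 0 1) + card (?B 1 1)"
    using fin by (intro card_Un_disjoint) (auto simp: sq_box_def)
  finally have card: "card (T \<inter> sq_box b (2 ^ Suc i)) =
      card (?B 0 0) + card (?B 1 0) + (card (?B 0 1) + card (?B 1 1))" .
  have "breadth j (T \<inter> sq_box b (2 ^ Suc i)) \<le> breadth j (?B 0 0 \<union> ?B 1 0) + breadth j (?B 0 1 \<union> ?B 1 1)"
    unfolding split by (rule breadth_Un)
  also have "\<dots> \<le> (breadth j (?B 0 0) + breadth j (?B 1 0)) + (breadth j (?B 0 1) + breadth j (?B 1 1))"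
    by (intro add_mono breadth_Un)
  finally have "?w * breadth j (T \<inter> sq_box b (2 ^ Suc i)) \<le> ?w * \<dots>" by (rule mult_le_mono2)
  also have "\<dots> \<le> card (T \<inter> sq_box b (2 ^ Suc i)) + 4 * ?w"
    using small'[of 0 0] small'[of 1 0] small'[of 0 1] small'[of 1 1] unfolding card
    by (simp add: distrib_left)
  finally show ?thesis by simp
qed

lemma staged_append:
  "staged P xs S us \<Longrightarrow> staged P ys (result S us) vs \<Longrightarrow> staged P (xs @ ys) S (us @ vs)"
proof (induction xs arbitrary: S us)
  case (Cons x xs)
  then obtain as bs where "us = as @ bs" "P x S as" "staged P xs (result S as) bs" by auto
  moreover from this have "staged P (xs @ ys) (result S as) (bs @ vs)"
    using Cons.IH Cons.prems(2) by simp
  ultimately show ?case by (auto intro: exI[of _ as] exI[of _ "bs @ vs"])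
qed simp

text \<open>Indices at the next scale are a function of the present ones, so equality of index sets
  is inherited by the coarser scale.\<close>

lemma box_index_double:
  "box_index c (2 ^ Suc i) p = (\<lambda>(u, v). (u div 2, v div 2)) (box_index c (2 ^ i) p)"
proof -
  have "a div int (2 ^ Suc i) = a div int (2 ^ i) div 2" for a
  proof -
    have "int (2 ^ Suc i) = int (2 ^ i) * 2" by simp
    then show ?thesis by (simp only: zdiv_zmult2_eq)
  qed
  then show ?thesis by (simp only: box_index_def prod.case)
qed

text \<open>The index set is compared with that of the original \<open>S\<close>, so that a quantity
  \<open>K\<close> of the start shape alone bounds the cost of every phase.\<close>

lemma phases_exist:
  assumes "finite S" "S \<subseteq> sq_box c (2 ^ d)" "k \<le> d"
    and K: "\<And>i. i \<le> d \<Longrightarrow> 4 * card S + 5 * 2 ^ i * card (box_index c (2 ^ i) ` S) \<le> K"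
  shows "\<exists>ms. line_moves S ms \<and> confined (sq_box c (2 ^ d)) ms \<and>
    staged (ubox_phase c d) [1..<k + 1] S ms \<and> length ms \<le> k * K \<and>
    box_index c (2 ^ k) ` result S ms = box_index c (2 ^ k) ` S \<and>
    (\<forall>b\<in>sub_boxes c d k.
      2 ^ k * breadth (Suc k) (result S ms \<inter> sq_box b (2 ^ k)) \<le> card (result S ms \<inter> sq_box b (2 ^ k)) + 2 ^ k \<and>
      (k \<ge> 1 \<longrightarrow> card (result S ms \<inter> sq_box b (2 ^ k)) \<le> 2 ^ k \<longrightarrow>
        result S ms \<inter> sq_box b (2 ^ k) = final_line k b (card (result S ms \<inter> sq_box b (2 ^ k)))))"
  using assms(3)
proof (induction k)
  case 0
  \<comment> \<open>Before the first phase, with boxes of side 1, the bound is trivial: there are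
    never more nonempty lines than nodes.\<close>
  have "breadth 1 (S \<inter> X) \<le> Suc (card (S \<inter> X))" for X
    using assms(1) by (simp add: breadth_def card_image_le le_SucI)
  then show ?case by (intro exI[of _ "[]"]) simp
next
  case (Suc k)
  then obtain us where us: "line_moves S us" "confined (sq_box c (2 ^ d)) us"
    "staged (ubox_phase c d) [1..<k + 1] S us" "length us \<le> k * K"
    "box_index c (2 ^ k) ` result S us = box_index c (2 ^ k) ` S"
    "\<forall>b\<in>sub_boxes c d k.
      2 ^ k * breadth (Suc k) (result S us \<inter> sq_box b (2 ^ k)) \<le> card (result S us \<inter> sq_box b (2 ^ k)) + 2 ^ k"
    by auto
  let ?S = "result S us"
  have fin: "finite ?S" "card ?S = card S" using line_moves_card[OF us(1) assms(1)] by auto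
  have sub: "?S \<subseteq> sq_box c (2 ^ d)" using result_minus[OF us(2), of S] assms(2) by blast
  have index: "box_index c (2 ^ Suc k) ` ?S = box_index c (2 ^ Suc k) ` S"
  proof -
    have "box_index c (2 ^ Suc k) ` X = (\<lambda>(u, v). (u div 2, v div 2)) ` (box_index c (2 ^ k) ` X)" for X
      unfolding image_image by (intro image_cong refl box_index_double)
    then show ?thesis using us(5) by simp
  qed
  have "\<exists>vs. line_moves ?S vs \<and> confined (sq_box c (2 ^ d)) vs \<and> ubox_phase c d (Suc k) ?S vs \<and>
    length vs \<le> 4 * card ?S + 5 * 2 ^ Suc k * card (box_index c (2 ^ Suc k) ` ?S) \<and>
    box_index c (2 ^ Suc k) ` result ?S vs = box_index c (2 ^ Suc k) ` ?S \<and>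
    (\<forall>b\<in>sub_boxes c d (Suc k).
      2 ^ Suc k * breadth (Suc (Suc k)) (result ?S vs \<inter> sq_box b (2 ^ Suc k)) \<le>
        card (result ?S vs \<inter> sq_box b (2 ^ Suc k)) + 2 ^ Suc k \<and>
      card (result ?S vs \<inter> sq_box b (2 ^ Suc k)) = card (?S \<inter> sq_box b (2 ^ Suc k)) \<and>
      (card (?S \<inter> sq_box b (2 ^ Suc k)) \<le> 2 ^ Suc k \<longrightarrow>
        result ?S vs \<inter> sq_box b (2 ^ Suc k) = final_line (Suc k) b (card (?S \<inter> sq_box b (2 ^ Suc k)))))"
  proof (rule phase_exists[OF fin(1) sub Suc.prems])
    show "2 ^ Suc k * breadth (Suc k) (?S \<inter> sq_box b (2 ^ Suc k)) \<le>
        2 * card (?S \<inter> sq_box b (2 ^ Suc k)) + 4 * 2 ^ Suc k" if "b \<in> sub_boxes c d (Suc k)" for b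
      using merge_boxes[OF fin(1) Suc.prems that] us(6) by blast
  qed
  then obtain vs where vs: "line_moves ?S vs" "confined (sq_box c (2 ^ d)) vs"
    "ubox_phase c d (Suc k) ?S vs"
    "length vs \<le> 4 * card ?S + 5 * 2 ^ Suc k * card (box_index c (2 ^ Suc k) ` ?S)"
    "box_index c (2 ^ Suc k) ` result ?S vs = box_index c (2 ^ Suc k) ` ?S"
    "\<forall>b\<in>sub_boxes c d (Suc k).
      2 ^ Suc k * breadth (Suc (Suc k)) (result ?S vs \<inter> sq_box b (2 ^ Suc k)) \<le>
        card (result ?S vs \<inter> sq_box b (2 ^ Suc k)) + 2 ^ Suc k \<and>
      card (result ?S vs \<inter> sq_box b (2 ^ Suc k)) = card (?S \<inter> sq_box b (2 ^ Suc k)) \<and>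
      (card (?S \<inter> sq_box b (2 ^ Suc k)) \<le> 2 ^ Suc k \<longrightarrow>
        result ?S vs \<inter> sq_box b (2 ^ Suc k) = final_line (Suc k) b (card (?S \<inter> sq_box b (2 ^ Suc k))))"
    by blast
  let ?T = "result ?S vs"
  have "length vs \<le> K" using vs(4) K[OF Suc.prems] unfolding fin(2) index by linarith
  moreover have "staged (ubox_phase c d) [1..<Suc k + 1] S (us @ vs)"
    using staged_append[OF us(3), of "[Suc k]" vs] vs(3) by simp
  moreover have "\<forall>b\<in>sub_boxes c d (Suc k).
      2 ^ Suc k * breadth (Suc (Suc k)) (?T \<inter> sq_box b (2 ^ Suc k)) \<le> card (?T \<inter> sq_box b (2 ^ Suc k)) + 2 ^ Suc k \<and>
      (Suc k \<ge> 1 \<longrightarrow> card (?T \<inter> sq_box b (2 ^ Suc k)) \<le> 2 ^ Suc k \<longrightarrow>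
        ?T \<inter> sq_box b (2 ^ Suc k) = final_line (Suc k) b (card (?T \<inter> sq_box b (2 ^ Suc k))))"
    using vs(6) by metis
  moreover have "box_index c (2 ^ Suc k) ` ?T = box_index c (2 ^ Suc k) ` S"
    using vs(5) index by (rule trans)
  ultimately show ?case
    using us(1,2,4) vs(1,2) by (intro exI[of _ "us @ vs"]) (simp only: result_append line_moves_append confined_simps length_append, simp)
qed

section \<open>Connected shapes\<close>

text \<open>Otherwise every path in \<open>S\<close> that starts in \<open>V\<close> would stay in
  \<open>V\<close>.\<close>

lemma connected_step_out:
  assumes "connected_shape S" "p \<in> S" "q \<in> S" "p \<in> V" "q \<notin> V"
  obtains u v where "u \<in> S \<inter> V" "v \<in> S - V" "neighbours u v"
proof (rule ccontr)
  assume no: "\<not> thesis"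
  have "(\<lambda>u v. u \<in> S \<and> v \<in> S \<and> neighbours u v)\<^sup>*\<^sup>* p q"
    using assms by (auto simp: connected_shape_def)
  then have "q \<in> V"
    by induction (use assms(4) no that in blast)+
  then show False using assms(5) by simp
qed

text \<open>Each new node is visited by a detour of two steps.\<close>

lemma covering_walk:
  assumes "connected_shape S" "finite S" "1 \<le> k" "k \<le> card S"
  shows "\<exists>xs. set xs \<subseteq> S \<and> card (set xs) = k \<and> length xs \<le> 2 * k \<and> successively neighbours xs"
  using assms(3,4)
proof (induction k rule: dec_induct)
  case base
  then have "S \<noteq> {}" by auto
  then obtain p where "p \<in> S" by blast
  then show ?case by (intro exI[of _ "[p]"]) auto
next
  case (step k)
  then obtain xs where xs: "set xs \<subseteq> S" "card (set xs) = k" "length xs \<le> 2 * k" "successively neighbours xs"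
    by auto
  have "xs \<noteq> []" using xs(2) step(1) by auto
  then obtain p where p: "p \<in> set xs" using hd_in_set by blast
  have "set xs \<noteq> S" using xs(2) step(4) by auto
  then obtain q where "q \<in> S" "q \<notin> set xs" using xs(1) by blast
  then obtain u v where uv: "u \<in> S \<inter> set xs" "v \<in> S - set xs" "neighbours u v"
    using connected_step_out[OF assms(1), of p q "set xs"] p xs(1) by blast
  then obtain ys zs where split: "xs = ys @ u # zs" by (meson IntD2 split_list)
  have "neighbours v u" using uv(3) by (auto simp: neighbours_def)
  then have "successively neighbours (ys @ u # v # u # zs)"
    using xs(4) uv(3) unfolding split by (auto simp: successively_append_iff)
  moreover have "set (ys @ u # v # u # zs) = insert v (set xs)" unfolding split by auto
  ultimately show ?case using xs uv
    by (intro exI[of _ "ys @ u # v # u # zs"]) (auto simp: split)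
qed

lemma walk_extent:
  "successively neighbours (h # xs) \<Longrightarrow> z \<in> set (h # xs) \<Longrightarrow>
    \<bar>fst z - fst h\<bar> \<le> int (length xs) \<and> \<bar>snd z - snd h\<bar> \<le> int (length xs)"
proof (induction xs arbitrary: h)
  case (Cons a xs)
  show ?case
  proof (cases "z = h")
    case False
    then show ?thesis using Cons by (fastforce simp: neighbours_def)
  qed simp
qed simp

text \<open>A walk of at most \<open>w\<close> cells stays at distance less than \<open>w\<close>
  from its first cell, so each box coordinate differs by at most 1, which leaves a 3 by 3 array of
  boxes.\<close>

lemma short_walk_boxes:
  assumes "successively neighbours xs" "length xs \<le> w" "w > 0"
  shows "card (box_index c w ` set xs) \<le> 9"
proof (cases xs)
  case (Cons h ys)
  define u v where "u = fst (box_index c w h)" and "v = snd (box_index c w h)"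
  have near: "a div int w \<in> {b div int w - 1..b div int w + 1}" if "\<bar>a - b\<bar> < int w" for a b
  proof -
    have "a div int w \<le> (b + 1 * int w) div int w" "(b + (-1) * int w) div int w \<le> a div int w"
      using that assms(3) by (intro zdiv_mono1; simp)+
    then show ?thesis using assms(3) by (simp only: div_mult_self1) simp
  qed
  have "box_index c w ` set xs \<subseteq> {u - 1..u + 1} \<times> {v - 1..v + 1}"
  proof
    fix t assume "t \<in> box_index c w ` set xs"
    then obtain z where z: "z \<in> set (h # ys)" "t = box_index c w z" unfolding Cons by blast
    have "\<bar>(fst z - fst c) - (fst h - fst c)\<bar> < int w" "\<bar>(snd z - snd c) - (snd h - snd c)\<bar> < int w"
      using walk_extent[OF assms(1)[unfolded Cons] z(1)] assms(2) Cons by auto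
    from near[OF this(1)] near[OF this(2)] show "t \<in> {u - 1..u + 1} \<times> {v - 1..v + 1}"
      unfolding z(2) u_def v_def box_index_def by simp
  qed
  then have "card (box_index c w ` set xs) \<le> card ({u - 1..u + 1} \<times> {v - 1..v + 1})"
    by (intro card_mono) auto
  then show ?thesis by (simp add: card_cartesian_product)
qed simp

text \<open>The walk is cut into pieces of \<open>w\<close> cells; the summand \<open>w\<close>
  accounts for the last, possibly shorter piece.\<close>

lemma walk_boxes:
  assumes "w > 0" "successively neighbours xs"
  shows "w * card (box_index c w ` set xs) \<le> 9 * (length xs + w)"
  using assms(2)
proof (induction "length xs" arbitrary: xs rule: less_induct)
  case less
  show ?case
  proof (cases "length xs \<le> w")
    case True
    have "w * card (box_index c w ` set xs) \<le> w * 9"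
      using short_walk_boxes[OF less.prems True assms(1)] by (rule mult_le_mono2)
    also have "w * 9 \<le> 9 * (length xs + w)" by simp
    finally show ?thesis .
  next
    case False
    have succ: "successively neighbours (take w xs)" "successively neighbours (drop w xs)"
      using less.prems by (metis append_take_drop_id successively_append_iff)+
    have "set xs = set (take w xs) \<union> set (drop w xs)" by (metis append_take_drop_id set_append)
    then have "card (box_index c w ` set xs) \<le>
        card (box_index c w ` set (take w xs)) + card (box_index c w ` set (drop w xs))"
      by (metis card_Un_le image_Un)
    also have "card (box_index c w ` set (take w xs)) \<le> 9"
      using short_walk_boxes[OF succ(1)] assms(1) by simp
    finally have "w * card (box_index c w ` set xs) \<le> w * (9 + card (box_index c w ` set (drop w xs)))"
      by (intro mult_le_mono2) simp
    also have "\<dots> \<le> w * 9 + 9 * (length (drop w xs) + w)"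
      using less.hyps[OF _ succ(2)] False assms(1) by (simp add: distrib_left)
    also have "\<dots> = 9 * (length xs + w)" using False by simp
    finally show ?thesis .
  qed
qed

lemma connected_boxes:
  assumes "connected_shape S" "finite S" "S \<noteq> {}" "w > 0"
  shows "w * card (box_index c w ` S) \<le> 9 * (2 * card S + w)"
proof -
  have "1 \<le> card S" using assms(2,3) by (simp add: Suc_le_eq card_gt_0_iff)
  then obtain xs where "set xs \<subseteq> S" "card (set xs) = card S" "length xs \<le> 2 * card S"
      "successively neighbours xs"
    using covering_walk[OF assms(1,2)] by blast
  moreover from this have "set xs = S" using assms(2) by (simp add: card_subset_eq)
  ultimately show ?thesis using walk_boxes[OF assms(4), of xs c] by (simp add: mult_le_mono2 order_trans)
qed

text \<open>A discrete intermediate value theorem: \<open>f\<close> changes by at most 1 between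
  neighbours, so on \<open>S\<close> it attains every integer from its minimum to
  \<open>f p\<close>, and each of these values needs a node of its own.\<close>

lemma connected_extent:
  fixes f :: "cell \<Rightarrow> int"
  assumes "connected_shape S" "finite S" "p \<in> S"
    and lip: "\<And>p q. neighbours p q \<Longrightarrow> \<bar>f p - f q\<bar> \<le> 1"
  shows "f p < Min (f ` S) + int (card S)"
proof -
  let ?m = "Min (f ` S)"
  have "?m \<in> f ` S" using assms(2,3) by (intro Min_in) auto
  then obtain r where r: "r \<in> S" "f r = ?m" by (metis imageE)
  have "{?m..f p} \<subseteq> f ` S"
  proof
    fix x assume x: "x \<in> {?m..f p}"
    show "x \<in> f ` S"
    proof (rule ccontr)
      assume no: "x \<notin> f ` S"
      then have "r \<in> {z. f z < x}" "p \<notin> {z. f z < x}" using x r by force+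
      from connected_step_out[OF assms(1) r(1) assms(3) this]
      obtain u v where uv: "u \<in> S \<inter> {z. f z < x}" "v \<in> S - {z. f z < x}" "neighbours u v"
        by blast
      then have "f v = x" using lip[of u v] by auto
      then show False using no uv(2) by blast
    qed
  qed
  then have "card {?m..f p} \<le> card (f ` S)" using assms(2) by (intro card_mono) auto
  also have "\<dots> \<le> card S" using assms(2) by (rule card_image_le)
  finally show ?thesis by simp
qed

lemma connected_enclosed:
  assumes "connected_shape S" "finite S" "card S \<le> w"
  shows "\<exists>c. S \<subseteq> sq_box c w"
proof
  show "S \<subseteq> sq_box (Min (fst ` S), Min (snd ` S)) w"
  proof
    fix p assume p: "p \<in> S"
    have "fst p < Min (fst ` S) + int (card S)" "snd p < Min (snd ` S) + int (card S)"
      by (rule connected_extent[OF assms(1,2) p]; simp add: neighbours_def)+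
    moreover have "Min (fst ` S) \<le> fst p" "Min (snd ` S) \<le> snd p" using p assms(2) by auto
    ultimately show "p \<in> sq_box (Min (fst ` S), Min (snd ` S)) w"
      using assms(3) by (cases p) (auto simp: sq_box_def)
  qed
qed

section \<open>Total cost and the common final line\<close>

lemma u_box_doubling_exists:
  assumes "connected_shape S" "finite S" "card S = n" "n \<ge> 2"
  shows "\<exists>c ms. u_box_doubling S ms \<and> length ms \<le> 184 * n * ceillog2 n \<and>
    result S ms = final_line (ceillog2 n) c n"
proof -
  let ?d = "ceillog2 n"
  have d: "n \<le> 2 ^ ?d" "2 ^ ?d < 2 * n" "1 \<le> ?d"
    using le_two_power_ceillog2[of n] two_power_ceillog2_gt[of n] ceillog2_ge_iff[of n 1] assms(4) by auto
  obtain c where c: "S \<subseteq> sq_box c (2 ^ ?d)"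
    using connected_enclosed[OF assms(1,2)] assms(3) d(1) by blast
  have "S \<noteq> {}" using assms(3,4) by auto
  \<comment> \<open>Since \<open>2 ^ i \<le> 2 * n\<close>, the side times the number of occupied
    boxes is at most \<open>9 * 4 * n = 36 * n\<close>, and
    \<open>4 * n + 5 * 36 * n = 184 * n\<close>.\<close>
  have K: "4 * card S + 5 * 2 ^ i * card (box_index c (2 ^ i) ` S) \<le> 184 * n" if "i \<le> ?d" for i
  proof -
    have "2 ^ i * card (box_index c (2 ^ i) ` S) \<le> 9 * (2 * n + 2 ^ i)"
      using connected_boxes[OF assms(1,2) \<open>S \<noteq> {}\<close>, of "2 ^ i" c] assms(3) by simp
    moreover have "(2::nat) ^ i \<le> 2 ^ ?d" using that by (intro power_increasing) auto
    then have "2 ^ i \<le> 2 * n" using d(2) by (meson le_less_trans less_imp_le)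
    then have "9 * (2 * n + 2 ^ i) \<le> 9 * (4 * n)" by simp
    ultimately have "2 ^ i * card (box_index c (2 ^ i) ` S) \<le> 9 * (4 * n)" by (rule order_trans)
    then show ?thesis using assms(3) by simp
  qed
  obtain ms where ms: "line_moves S ms" "confined (sq_box c (2 ^ ?d)) ms"
      "staged (ubox_phase c ?d) [1..<?d + 1] S ms" "length ms \<le> ?d * (184 * n)"
      "\<forall>b\<in>sub_boxes c ?d ?d.
        2 ^ ?d * breadth (Suc ?d) (result S ms \<inter> sq_box b (2 ^ ?d)) \<le> card (result S ms \<inter> sq_box b (2 ^ ?d)) + 2 ^ ?d \<and>
        (?d \<ge> 1 \<longrightarrow> card (result S ms \<inter> sq_box b (2 ^ ?d)) \<le> 2 ^ ?d \<longrightarrow>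
        result S ms \<inter> sq_box b (2 ^ ?d) = final_line ?d b (card (result S ms \<inter> sq_box b (2 ^ ?d))))"
    using phases_exist[OF assms(2) c order_refl K] by blast
  \<comment> \<open>At the top scale the enclosing box is its own sub-box and contains the whole
    result; its \<open>n \<le> 2 ^ ?d\<close> nodes fit into one line.\<close>
  have "result S ms \<subseteq> sq_box c (2 ^ ?d)" using result_minus[OF ms(2), of S] c by blast
  then have box: "result S ms \<inter> sq_box c (2 ^ ?d) = result S ms" by blast
  have "card (result S ms) = n" using line_moves_card[OF ms(1) assms(2)] assms(3) by simp
  moreover have "c \<in> sub_boxes c ?d ?d" by (cases c) (simp add: sub_boxes_def)
  ultimately have "result S ms = final_line ?d c n" using bspec[OF ms(5), of c] d(1,3) box by simp
  moreover have "u_box_doubling S ms"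
    using ms(1,3) c unfolding u_box_doubling_def assms(3) Let_def by blast
  ultimately show ?thesis using ms(4) by (intro exI[of _ c] exI[of _ ms]) (simp add: mult.commute)
qed

text \<open>Both runs end in lines of equal length and direction, so a translation \<open>g\<close>,
  without rotation, makes the ends coincide. The reversed translated run of \<open>B\<close> then
  leads on to the translated copy of \<open>B\<close>, which is a placement. Two runs of 184 each
  give 368.\<close>

lemma transformation_exists:
  assumes A: "connected_shape A" "finite A" "card A = n"
    and B: "connected_shape B" "finite B" "card B = n" and "n \<ge> 2"
  shows "\<exists>ms. transforms A ms B \<and> via_u_box_doubling A ms B \<and> length ms \<le> 368 * n * ceillog2 n"
proof -
  let ?d = "ceillog2 n"
  obtain a us where us: "u_box_doubling A us" "length us \<le> 184 * n * ?d"
      "result A us = final_line ?d a n"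
    using u_box_doubling_exists[OF A \<open>n \<ge> 2\<close>] by blast
  obtain b vs where vs: "u_box_doubling B vs" "length vs \<le> 184 * n * ?d"
      "result B vs = final_line ?d b n"
    using u_box_doubling_exists[OF B \<open>n \<ge> 2\<close>] by blast
  define g where "g = (\<lambda>p::cell. (fst p + (fst a - fst b), snd p + (snd a - snd b)))"
  have "rigid_motion g"
    unfolding rigid_motion_def g_def
    by (intro exI[of _ 0] exI[of _ "fst a - fst b"] exI[of _ "snd a - snd b"]) simp
  have "inj g" by (auto simp: g_def inj_def prod_eq_iff)
  have meet: "result A us = g ` result B vs"
    unfolding us(3) vs(3) g_def final_line_def by simp
  have "line_moves (g ` B) (map_moves g vs)"
    using vs(1) line_move_translate \<open>inj g\<close> unfolding u_box_doubling_def g_def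
    by (intro line_moves_map_moves) auto
  from line_moves_reverse[OF this]
  have rev: "line_moves (result A us) (reverse_moves (map_moves g vs))"
      "result (result A us) (reverse_moves (map_moves g vs)) = g ` B"
    unfolding result_map_moves[OF \<open>inj g\<close>] meet by auto
  let ?ms = "us @ reverse_moves (map_moves g vs)"
  have "transforms A ?ms B"
    using us(1) rev \<open>rigid_motion g\<close>
    by (auto simp: transforms_def u_box_doubling_def placement_of_def)
  moreover have "via_u_box_doubling A ?ms B"
    unfolding via_u_box_doubling_def using us(1) vs(1) \<open>rigid_motion g\<close> meet by blast
  moreover have "length ?ms \<le> 368 * n * ?d"
    using us(2) vs(2) by (simp add: reverse_moves_def)
  ultimately show ?thesis by blast
qed

theorem theorem4p12:
  "\<exists>C::real. C > 0 \<and>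
     (\<forall>(n::nat) S_I S_F. n \<ge> 2 \<longrightarrow>
        finite S_I \<longrightarrow> card S_I = n \<longrightarrow> connected_shape S_I \<longrightarrow>
        finite S_F \<longrightarrow> card S_F = n \<longrightarrow> connected_shape S_F \<longrightarrow>
        (\<exists>ms. transforms S_I ms S_F \<and> via_u_box_doubling S_I ms S_F \<and>
              real (length ms) \<le> C * real n * log 2 (real n)) \<and>
        (\<exists>ms. transforms S_F ms S_I \<and> via_u_box_doubling S_F ms S_I \<and>
              real (length ms) \<le> C * real n * log 2 (real n)))"
proof -
  have bound: "real l \<le> 736 * real n * log 2 (real n)" if "l \<le> 368 * n * ceillog2 n" "n \<ge> 2" for l n :: nat
  proof -
    \<comment> \<open>For \<open>n \<ge> 2\<close> the logarithm is at least 1, so rounding it up at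
      most doubles it; this turns 368 into 736.\<close>
    have "1 \<le> log 2 (real n)" using that(2) by (simp add: le_log_iff)
    then have "real (ceillog2 n) \<le> 2 * log 2 (real n)"
      using ceillog2_less_log[of n] that(2) by linarith
    then have "368 * real n * real (ceillog2 n) \<le> 368 * real n * (2 * log 2 (real n))"
      by (intro mult_left_mono) auto
    moreover have "real l \<le> real (368 * n * ceillog2 n)" using that(1) by (rule of_nat_mono)
    ultimately show ?thesis by simp
  qed
  show ?thesis
  proof (intro exI[of _ 736] conjI allI impI)
    fix n :: nat and S_I S_F :: shape
    assume n: "n \<ge> 2" and I: "finite S_I" "card S_I = n" "connected_shape S_I"
      and F: "finite S_F" "card S_F = n" "connected_shape S_F"
    show "\<exists>ms. transforms S_I ms S_F \<and> via_u_box_doubling S_I ms S_F \<and>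
        real (length ms) \<le> 736 * real n * log 2 (real n)"
      using transformation_exists[OF I(3,1,2) F(3,1,2) n] bound n by blast
    show "\<exists>ms. transforms S_F ms S_I \<and> via_u_box_doubling S_F ms S_I \<and>
        real (length ms) \<le> 736 * real n * log 2 (real n)"
      using transformation_exists[OF F(3,1,2) I(3,1,2) n] bound n by blast
  qed simp
qed

end
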